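(* Let $d\ge1$, and let $k$, $\eta$, $v$ satisfy the assumptions (A1)–(A6) listed in the context. Then there exist $\beta\in(0,1)$, $r_0>0$, a sufficiently small constant $c'>0$ and a constant $K>0$, depending only on $d$, $\eta$ and the constants in the assumptions (and not on $q$), such that if $q(t,x)$ is a bounded solution of $$\partial_t q+v(t,x)\cdot\nabla q+\mathscr{L}q=0,\qquad \mathscr{L}q(t,x)=\int_{\mathbb{R}^d}\big(q(t,x)-q(t,x+z)\big)k(x,z,t)\,dz,$$ in $\mathbb{R}^d$, then for any $0<t\le1$ and any $x\ne y$ with $|x-y|\le\min(r_0,M_\eta^{-1}(c'/t))$, $$|q(t,x)-q(t,y)|\le K\,t^{-\beta}\,[M_\eta(|x-y|)]^{-\beta}\sup_{0\le s\le1,\;z\in\mathbb{R}^d}|q(s,z)|.$$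
   Context: Assumptions: (A1) there exist $C>0$ and a function $\eta:(0,\infty)\to[0,\infty)$ such that $\frac1C\eta(|z|)\le k(x,z,t)\le C\eta(|z|)$ for all $x,z,t$; (A2) for any $\alpha\in(0,1)$ there exists $c_\alpha>0$ such that $\eta(r)\ge \frac{1}{c_\alpha r^{d-\alpha}}$ for all $0<r\le1$; (A3) $M_\eta(r):=\int_r^\infty\eta(s)s^{d-1}\,ds$ is finite for $r>0$ and $M_\eta(r)\to+\infty$ as $r\to0$; (A4) there exists $r_0>0$ such that $\frac{r^d\eta(r)}{M_\eta(r)}$ is non-decreasing for $0<r\le r_0$; (A5) there exist $\gamma\in(0,1/2]$ and $r_0>0$ such that $r^\gamma M_\eta(r)$ is non-decreasing for $0<r\le r_0$ (in particular $sM_\eta(s)\le rM_\eta(r)$ for $0<s\le r\le r_0$); (A6) there exist $C,C'>0$ such that $|v(t,x)|\le C(1+|x|)$ for all $t\ge0$, $x\in\mathbb{R}^d$, and $|v(t,x)-v(t,y)|\le C'|x-y|\,M_\eta(|x-y|)$ for all $t\ge0$ and $0<|x-y|\le1$. $M_\eta^{-1}$ denotes the inverse function of the decreasing function $M_\eta$; the condition $|x-y|\le M_\eta^{-1}(c'/t)$ means $M_\eta(|x-y|)\ge c'/t$. *)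

theory Defs
  imports "HOL-Analysis.Analysis"
begin

text \<open>
  The profile \<open>\<eta>\<close> lives on \<open>(0,\<infinity>)\<close>; as a total function on \<open>real\<close> its values at
  non-positive arguments are never used. The dimension \<open>d\<close> is \<open>DIM('a)\<close> below.
\<close>

definition M_eta :: "nat \<Rightarrow> (real \<Rightarrow> real) \<Rightarrow> real \<Rightarrow> real" where
  "M_eta d \<eta> r = (LINT s:{r..}|lebesgue. \<eta> s * s ^ (d - 1))"

text \<open>
  The condition is imposed for \<open>z \<noteq> 0\<close> only, since \<open>\<eta>\<close> is not defined at \<open>0\<close>. Measurability
  of \<open>k\<close> in \<open>z\<close> is implicit in the integral defining the operator; nothing is required in
  \<open>x\<close> and \<open>t\<close>.
\<close>

definition assm_A1 ::
    "real \<Rightarrow> (real \<Rightarrow> real) \<Rightarrow> ('a::euclidean_space \<Rightarrow> 'a \<Rightarrow> real \<Rightarrow> real) \<Rightarrow> bool" where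
  "assm_A1 C \<eta> k \<longleftrightarrow>
     (\<forall>t\<ge>0. \<forall>x. (\<lambda>z. k x z t) \<in> borel_measurable lebesgue) \<and>
     (\<forall>t\<ge>0. \<forall>x z. z \<noteq> 0 \<longrightarrow>
        1 / C * \<eta> (norm z) \<le> k x z t \<and> k x z t \<le> C * \<eta> (norm z))"

definition assm_A2 :: "nat \<Rightarrow> (real \<Rightarrow> real) \<Rightarrow> bool" where
  "assm_A2 d \<eta> \<longleftrightarrow>
     (\<forall>\<alpha>. 0 < \<alpha> \<and> \<alpha> < 1 \<longrightarrow>
        (\<exists>c>0. \<forall>r. 0 < r \<and> r \<le> 1 \<longrightarrow> \<eta> r \<ge> 1 / (c * r powr (real d - \<alpha>))))"

text \<open>Since \<open>\<eta> \<ge> 0\<close>, finiteness of \<open>M_eta\<close> is integrability.\<close>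

definition assm_A3 :: "nat \<Rightarrow> (real \<Rightarrow> real) \<Rightarrow> bool" where
  "assm_A3 d \<eta> \<longleftrightarrow>
     (\<forall>r>0. set_integrable lebesgue {r..} (\<lambda>s. \<eta> s * s ^ (d - 1))) \<and>
     filterlim (M_eta d \<eta>) at_top (at_right 0)"

definition assm_A4 :: "nat \<Rightarrow> (real \<Rightarrow> real) \<Rightarrow> bool" where
  "assm_A4 d \<eta> \<longleftrightarrow>
     (\<exists>r0>0. mono_on {0<..r0} (\<lambda>r. r ^ d * \<eta> r / M_eta d \<eta> r))"

definition assm_A5 :: "nat \<Rightarrow> (real \<Rightarrow> real) \<Rightarrow> bool" where
  "assm_A5 d \<eta> \<longleftrightarrow>
     (\<exists>\<gamma>. 0 < \<gamma> \<and> \<gamma> \<le> 1 / 2 \<and>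
        (\<exists>r0>0. mono_on {0<..r0} (\<lambda>r. r powr \<gamma> * M_eta d \<eta> r)))"

definition assm_A6 ::
    "real \<Rightarrow> real \<Rightarrow> (real \<Rightarrow> real) \<Rightarrow> (real \<Rightarrow> 'a::euclidean_space \<Rightarrow> 'a) \<Rightarrow> bool" where
  "assm_A6 C C' \<eta> v \<longleftrightarrow>
     (\<forall>t\<ge>0. \<forall>x. norm (v t x) \<le> C * (1 + norm x)) \<and>
     (\<forall>t\<ge>0. \<forall>x y. 0 < norm (x - y) \<and> norm (x - y) \<le> 1 \<longrightarrow>
        norm (v t x - v t y) \<le> C' * norm (x - y) * M_eta DIM('a) \<eta> (norm (x - y)))"

definition nonlocal_op ::
    "('a::euclidean_space \<Rightarrow> 'a \<Rightarrow> real \<Rightarrow> real) \<Rightarrow> (real \<Rightarrow> 'a \<Rightarrow> real) \<Rightarrow> real \<Rightarrow> 'a \<Rightarrow> real" where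
  "nonlocal_op k q t x = (LINT z|lebesgue. (q t x - q t (x + z)) * k x z t)"

text \<open>
  Solutions are classical: \<open>q\<close> is continuous for \<open>t > 0\<close>, has a time derivative and a spatial
  gradient at every point, the integral converges absolutely and the equation holds pointwise.
  Neither continuity of the derivatives nor continuity at \<open>t = 0\<close> is required.
\<close>

definition bounded_solution ::
    "('a::euclidean_space \<Rightarrow> 'a \<Rightarrow> real \<Rightarrow> real) \<Rightarrow> (real \<Rightarrow> 'a \<Rightarrow> 'a) \<Rightarrow> (real \<Rightarrow> 'a \<Rightarrow> real) \<Rightarrow> bool" where
  "bounded_solution k v q \<longleftrightarrow>
     (\<exists>B. \<forall>t\<ge>0. \<forall>x. \<bar>q t x\<bar> \<le> B) \<and>
     continuous_on ({0<..} \<times> UNIV) (\<lambda>(t, x). q t x) \<and>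
     (\<forall>t>0. \<forall>x.
        integrable lebesgue (\<lambda>z. (q t x - q t (x + z)) * k x z t) \<and>
        (\<exists>q' g. ((\<lambda>s. q s x) has_real_derivative q') (at t) \<and>
                gderiv (q t) x g \<and>
                q' + v t x \<bullet> g + nonlocal_op k q t x = 0))"

end

theory Submission
  imports Defs
begin

text \<open>
  The estimate is a maximum principle for the two-point function \<open>q t x - q t y\<close>. Write \<open>r\<close> for
  \<open>norm (x - y)\<close> and \<open>B\<close> for the supremum of \<open>\<bar>q\<bar>\<close>; the barrier is
  \<open>2 * B * min 1 ((t * N r / M \<rho>) powr (- \<beta>))\<close> with a fixed small radius \<open>\<rho>\<close> and
  \<open>N r = M (min r \<rho>)\<close>. It equals the trivial bound \<open>2 * B\<close> unless \<open>t * N r > M \<rho>\<close>, and for \<open>t \<le> 1\<close>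
  this forces \<open>r < \<rho>\<close>, where \<open>N r = M r\<close>. So taking
  \<open>c' = M \<rho>\<close> confines the comparison to the region where the scaling assumptions are available.

  Why the barrier is not crossed: think of two particles at \<open>x\<close> and \<open>y\<close> that jump with densities
  \<open>k x\<close> and \<open>k y\<close>. The two kernels may differ by a bounded factor, but both dominate a multiple of
  \<open>min (\<eta> (norm (p - x))) (\<eta> (norm (p - y)))\<close> as densities of the landing point \<open>p\<close>. Letting the two
  particles use this common part to jump to the \<^emph>\<open>same\<close> point makes them coalesce at a rate at least
  \<open>gain C * M r\<close>, so the nonlocal terms contribute a loss \<open>gain C * M r * \<Phi>\<close>, where \<open>\<Phi>\<close> is the value of
  the barrier. Everything else is of the same order \<open>M r * \<Phi>\<close> with an additional factor \<open>\<beta>\<close>, because the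
  barrier is nearly flat for small \<open>\<beta>\<close>:

  \<^item> the remaining part of the kernels moves one particle only; the relative increase of the barrier
    under a displacement \<open>z\<close> is at most \<open>\<beta> * Q r (norm z)\<close> (\<open>displacement_cost\<close>), and the integral of
    \<open>Q r\<close> against the jump measure is \<open>O(M r)\<close> (\<open>displacement_cost_integral\<close>);
  \<^item> the drift difference is at most \<open>C2 * r * M r\<close>, and the gradient at the maximum at most
    \<open>\<beta> * \<Phi> / r\<close>;
  \<^item> the time derivative of the barrier is \<open>\<beta> * \<Phi> / t \<le> \<beta> * M r * \<Phi> / M \<rho>\<close>.

  Choosing \<open>\<beta>\<close> small, the coalescence wins. The shared part is where the monotonicity of
  \<open>r ^ d * \<eta> r / M r\<close> enters (\<open>\<eta>\<close> does not drop by more than a constant factor from \<open>s\<close> to \<open>2 * s\<close>), and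
  the monotonicity of \<open>r powr \<gamma> * M r\<close> with \<open>\<gamma> \<le> 1 / 2\<close> makes the first moment of small jumps
  \<open>O(r * M r)\<close>, so that already first-order increments are integrable at the right scale.

  Two devices make the maximum exist. A bounded penalty of logarithmic type confines \<open>x\<close>: it has to be
  bounded because \<open>\<eta>\<close> is merely integrable at infinity, and its gradient has to decay like \<open>1 / norm x\<close>
  because the drift may grow linearly. And the barrier is started at a time \<open>\<tau> > 0\<close>, since \<open>q\<close> need
  not be continuous at time \<open>0\<close>. Both are removed in the limit. The core inequality is
  \<open>inequality_at_spatial_max\<close>, and the contradiction at a maximum is in \<open>penalized_comparison\<close>.
\<close>

section \<open>Polar coordinates for radial functions\<close>

definition sphere_area :: "'a::euclidean_space itself \<Rightarrow> real" where
  "sphere_area _ = real DIM('a) * unit_ball_vol (real DIM('a))"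

lemma sphere_area_pos: "0 < sphere_area TYPE('a::euclidean_space)"
  by (simp add: sphere_area_def)

text \<open>
  The two measures agree on every \<open>{..a}\<close>, where the left-hand side is the volume of a ball.
\<close>

lemma distr_norm_lborel:
  "distr (lborel :: 'a::euclidean_space measure) borel norm =
     density lborel (\<lambda>s. ennreal (sphere_area TYPE('a) * s ^ (DIM('a) - 1)) * indicator {0..} s)"
    (is "?L = ?R")
proof (rule measure_eqI_generator_eq[where E = "range (\<lambda>a::real. {..a})" and \<Omega> = UNIV
      and A = "\<lambda>n::nat. {..real n}"])
  show "Int_stable (range (\<lambda>a::real. {..a}))"
    by (auto simp: Int_stable_def)
  show "sets ?L = sigma_sets UNIV (range (\<lambda>a::real. {..a}))"
    by (simp add: borel_eq_atMost)
  show "sets ?R = sigma_sets UNIV (range (\<lambda>a::real. {..a}))"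
    by (simp add: borel_eq_atMost)
  have L: "emeasure ?L {..a} = (if a < 0 then 0 else ennreal (unit_ball_vol (DIM('a)) * a ^ DIM('a)))" for a
  proof (cases "a < 0")
    case True
    then have "norm -` {..a} \<inter> space lborel = ({} :: 'a set)"
      by auto (meson norm_ge_zero not_less order_trans)
    with True show ?thesis by (subst emeasure_distr) simp_all
  next
    case False
    have "norm -` {..a} \<inter> space lborel = (cball 0 a :: 'a set)" by auto
    with False show ?thesis by (subst emeasure_distr) (simp_all add: emeasure_cball)
  qed
  have R: "emeasure ?R {..a} = (if a < 0 then 0 else ennreal (unit_ball_vol (DIM('a)) * a ^ DIM('a)))" for a
  proof (cases "a < 0")
    case True
    then have *: "indicator {0..} s * indicator {..a} s = (0::ennreal)" for s :: real
      by (auto simp: indicator_def)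
    show ?thesis using True by (subst emeasure_density) (simp_all add: * mult.assoc)
  next
    case False
    have "emeasure ?R {..a} = (\<integral>\<^sup>+s. ennreal (sphere_area TYPE('a) * s ^ (DIM('a) - 1)) * indicator {0..a} s \<partial>lborel)"
      by (subst emeasure_density) (auto intro!: nn_integral_cong simp: indicator_def)
    also have "\<dots> = ennreal (unit_ball_vol (DIM('a)) * a ^ DIM('a) - unit_ball_vol (DIM('a)) * 0 ^ DIM('a))"
      using False
      by (intro nn_integral_FTC_Icc)
        (auto intro!: derivative_eq_intros mult_nonneg_nonneg less_imp_le[OF sphere_area_pos]
           simp: sphere_area_def)
    finally show ?thesis using False by simp
  qed
  show "emeasure ?L X = emeasure ?R X" if "X \<in> range (\<lambda>a::real. {..a})" for X
    using that L R by auto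
  show "emeasure ?L {..real n} \<noteq> \<infinity>" for n
    by (simp add: L)
  show "(\<Union>n. {..real n}) = UNIV"
    using real_arch_simple by auto
qed auto

text \<open>
  The law of the norm has a density, so the norm pulls null sets back to null sets.
\<close>

lemma AE_norm_if_AE_pos:
  fixes P :: "real \<Rightarrow> bool"
  assumes "AE s in lborel. 0 < s \<longrightarrow> P s"
  shows "AE z in (lborel :: 'a::euclidean_space measure). z \<noteq> 0 \<longrightarrow> P (norm z)"
proof -
  have "AE s in distr (lborel :: 'a measure) borel norm. 0 < s \<longrightarrow> P s"
    unfolding distr_norm_lborel
    using AE_density[of "\<lambda>s. ennreal (sphere_area TYPE('a) * s ^ (DIM('a) - 1)) * indicator {0..} s" lborel] assms by auto
  then obtain N where N: "N \<in> null_sets (distr (lborel :: 'a measure) borel norm)"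
    "{s. \<not> (0 < s \<longrightarrow> P s)} \<subseteq> N"
    unfolding eventually_ae_filter by auto
  from AE_not_in[OF N(1)] N(1) have "AE z in (lborel :: 'a measure). norm z \<notin> N"
    by (subst (asm) AE_distr_iff) (auto dest: null_setsD2)
  then show ?thesis
  proof eventually_elim
    case (elim z)
    then show ?case using N(2) by (metis (mono_tags, lifting) mem_Collect_eq subsetD zero_less_norm_iff)
  qed
qed

lemma nn_integral_norm:
  fixes g :: "real \<Rightarrow> ennreal"
  assumes [measurable]: "g \<in> borel_measurable borel"
  shows "(\<integral>\<^sup>+z. g (norm z) \<partial>(lborel :: 'a::euclidean_space measure)) =
     (\<integral>\<^sup>+s. ennreal (sphere_area TYPE('a) * s ^ (DIM('a) - 1)) * indicator {0..} s * g s \<partial>lborel)"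
proof -
  have "(\<integral>\<^sup>+z. g (norm z) \<partial>(lborel :: 'a measure)) = (\<integral>\<^sup>+s. g s \<partial>distr (lborel :: 'a measure) borel norm)"
    by (subst nn_integral_distr) auto
  then show ?thesis
    unfolding distr_norm_lborel by (subst (asm) nn_integral_density) auto
qed

section \<open>The jump measure and its tails\<close>

text \<open>
  \<open>M\<close>, \<open>\<sigma>\<close> and \<open>J\<close> are determined by \<open>\<eta>\<close>. They are parameters because the dimension enters only
  through the type \<open>'a\<close>, which \<open>J\<close> carries. Its value \<open>0\<close> at the origin makes it nonnegative
  whatever \<open>\<eta> 0\<close> is.
\<close>

locale radial_profile =
  fixes \<eta> M :: "real \<Rightarrow> real" and \<sigma> :: real and J :: "'a::euclidean_space \<Rightarrow> real"
  assumes nonneg: "0 < s \<Longrightarrow> 0 \<le> \<eta> s"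
    and tail_integrable: "0 < r \<Longrightarrow> set_integrable lebesgue {r..} (\<lambda>s. \<eta> s * s ^ (DIM('a) - 1))"
    and M_eq: "M = M_eta DIM('a) \<eta>"
    and \<sigma>_eq: "\<sigma> = sphere_area TYPE('a)"
    and J_def: "J z = (if z = 0 then 0 else \<eta> (norm z))"
begin

lemma \<sigma>_pos: "0 < \<sigma>"
  unfolding \<sigma>_eq by (rule sphere_area_pos)

lemmas M_def = M_eta_def[of "DIM('a)" \<eta>, folded M_eq]

definition \<nu> :: "'a measure" where
  "\<nu> = density lebesgue (\<lambda>z. ennreal (J z))"

lemma J_nonneg: "0 \<le> J z"
  by (simp add: J_def nonneg)

lemma M_nonneg: "0 < r \<Longrightarrow> 0 \<le> M r"
  unfolding M_def set_lebesgue_integral_def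
  by (rule integral_nonneg_AE) (auto simp: indicator_def nonneg)

lemma M_split:
  assumes "0 < a" "a \<le> r"
  shows "M a = integral {a..r} (\<lambda>s. \<eta> s * s ^ (DIM('a) - 1)) + M r"
proof -
  let ?f = "\<lambda>s. \<eta> s * s ^ (DIM('a) - 1)"
  have i: "set_integrable lebesgue {a..r} ?f"
    by (rule set_integrable_subset[OF tail_integrable[OF assms(1)]]) auto
  have "M a = (LINT s:{a..r} \<union> {r..}|lebesgue. ?f s)"
  proof -
    have "{a..} = {a..r} \<union> {r..}" using assms by auto
    then show ?thesis unfolding M_def by simp
  qed
  also have "\<dots> = (LINT s:{a..r}|lebesgue. ?f s) + M r"
    unfolding M_def
  proof (rule set_integral_Un_AE)
    have "AE s in lebesgue. s \<noteq> r"
      by (intro AE_completion AE_lborel_singleton)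
    then show "AE s in lebesgue. \<not> (s \<in> {a..r} \<and> s \<in> {r..})"
      by eventually_elim auto
  qed (use i tail_integrable assms in auto)
  also have "(LINT s:{a..r}|lebesgue. ?f s) = integral {a..r} ?f"
    using i by (rule set_lebesgue_integral_eq_integral(2))
  finally show ?thesis .
qed

lemma M_antimono:
  assumes "0 < a" "a \<le> r"
  shows "M r \<le> M a"
proof -
  have "0 \<le> integral {a..r} (\<lambda>s. \<eta> s * s ^ (DIM('a) - 1))"
  proof (rule Henstock_Kurzweil_Integration.integral_nonneg)
    have "set_integrable lebesgue {a..r} (\<lambda>s. \<eta> s * s ^ (DIM('a) - 1))"
      by (rule set_integrable_subset[OF tail_integrable[OF assms(1)]]) auto
    then show "(\<lambda>s. \<eta> s * s ^ (DIM('a) - 1)) integrable_on {a..r}"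
      by (rule set_lebesgue_integral_eq_integral(1))
  qed (use assms nonneg in auto)
  then show ?thesis using M_split[OF assms] by simp
qed

lemma continuous_on_M: "continuous_on {0<..} M"
proof -
  let ?f = "\<lambda>s. \<eta> s * s ^ (DIM('a) - 1)"
  have *: "continuous_on {a..b} M" if "0 < a" for a b
  proof -
    have "set_integrable lebesgue {a..b} ?f"
      by (rule set_integrable_subset[OF tail_integrable[OF that]]) auto
    then have "continuous_on {a..b} (\<lambda>r. M a - integral {a..r} ?f)"
      by (intro continuous_intros indefinite_integral_continuous_1 set_lebesgue_integral_eq_integral(1))
    then show ?thesis
      by (rule continuous_on_eq) (use M_split that in fastforce)
  qed
  have "isCont M x" if "0 < x" for x
  proof -
    have "continuous_on {x/2<..<2*x} M"
      by (rule continuous_on_subset[OF *[of "x/2" "2*x"]]) (use that in auto)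
    then show ?thesis
      using that by (simp add: continuous_on_eq_continuous_at)
  qed
  then show ?thesis
    by (simp add: continuous_at_imp_continuous_on)
qed

text \<open>
  \<open>\<eta>\<close> is only Lebesgue measurable, and composing with the norm need not preserve that a priori.
  It does here because the norm pulls null sets back to null sets.
\<close>

lemma ex_borel_profile:
  obtains g where "g \<in> borel_measurable borel"
    and "AE s in lborel. indicator {0<..} s * \<eta> s = g s"
    and "AE z in lborel. J z = g (norm z)"
proof -
  have "(\<lambda>s. indicator {0<..} s * \<eta> s) \<in> borel_measurable lebesgue"
  proof (rule borel_measurable_LIMSEQ_real)
    fix n :: nat
    have "(\<lambda>s. indicator {1 / real (Suc n)..} s *\<^sub>R (\<eta> s * s ^ (DIM('a) - 1))) \<in> borel_measurable lebesgue"
      using tail_integrable[of "1 / real (Suc n)"] unfolding set_integrable_def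
      by (intro borel_measurable_integrable) simp
    moreover have "(\<lambda>s::real. s ^ (DIM('a) - 1)) \<in> borel_measurable lebesgue"
      by (rule measurable_completion) measurable
    ultimately have "(\<lambda>s. indicator {1 / real (Suc n)..} s *\<^sub>R (\<eta> s * s ^ (DIM('a) - 1)) / s ^ (DIM('a) - 1)) \<in> borel_measurable lebesgue"
      by (rule borel_measurable_divide)
    also have "(\<lambda>s. indicator {1 / real (Suc n)..} s *\<^sub>R (\<eta> s * s ^ (DIM('a) - 1)) / s ^ (DIM('a) - 1)) =
        (\<lambda>s. indicator {1 / real (Suc n)..} s * \<eta> s)"
    proof
      fix s :: real
      have "s \<noteq> 0" if "1 / real (Suc n) \<le> s"
      proof -
        have "0 < 1 / real (Suc n)" by simp
        with that show ?thesis by linarith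
      qed
      then show "indicator {1 / real (Suc n)..} s *\<^sub>R (\<eta> s * s ^ (DIM('a) - 1)) / s ^ (DIM('a) - 1) =
        indicator {1 / real (Suc n)..} s * \<eta> s"
        by (auto simp: indicator_def)
    qed
    finally show "(\<lambda>s. indicator {1 / real (Suc n)..} s * \<eta> s) \<in> borel_measurable lebesgue" .
  next
    fix s :: real
    show "(\<lambda>n. indicator {1 / real (Suc n)..} s * \<eta> s) \<longlonglongrightarrow> indicator {0<..} s * \<eta> s"
    proof (cases "0 < s")
      case True
      then have "\<forall>\<^sub>F n in sequentially. 1 / real (Suc n) < s"
        using order_tendstoD(2)[OF LIMSEQ_inverse_real_of_nat] by (simp add: inverse_eq_divide)
      then have "\<forall>\<^sub>F n in sequentially. indicator {1 / real (Suc n)..} s * \<eta> s = indicator {0<..} s * \<eta> s"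
        by eventually_elim (use True in auto)
      then show ?thesis by (rule tendsto_eventually)
    next
      case False
      have "\<not> 1 / real (Suc n) \<le> s" for n
      proof -
        have "0 < 1 / real (Suc n)" by simp
        with False show ?thesis by linarith
      qed
      then show ?thesis using False by simp
    qed
  qed
  then obtain g where g [measurable]: "g \<in> borel_measurable lborel" and
    ae: "AE s in lborel. indicator {0<..} s * \<eta> s = g s"
    using completion_ex_borel_measurable_real by blast
  have "AE z in (lborel :: 'a measure). z \<noteq> 0 \<longrightarrow> indicator {0<..} (norm z) * \<eta> (norm z) = g (norm z)"
    using ae by (intro AE_norm_if_AE_pos) auto
  moreover have "AE z in (lborel :: 'a measure). z \<noteq> 0"
    by (rule AE_lborel_singleton)
  ultimately have "AE z in lborel. J z = g (norm z)"
    by eventually_elim (simp add: J_def)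
  then show ?thesis
    by (intro that[OF _ ae]) (use g in simp)
qed

lemma J_measurable [measurable]: "J \<in> borel_measurable lebesgue"
proof -
  obtain g where g [measurable]: "g \<in> borel_measurable borel" and ae: "AE z in lborel. J z = g (norm z)"
    using ex_borel_profile by blast
  have "(\<lambda>z::'a. g (norm z)) \<in> borel_measurable lborel"
    by measurable
  then have "(\<lambda>z::'a. g (norm z)) \<in> borel_measurable lebesgue"
    by (rule measurable_completion)
  then show ?thesis
  proof (rule borel_measurable_AE)
    show "AE z in lebesgue. g (norm z) = J z"
      by (intro AE_completion eventually_mono[OF ae]) simp
  qed
qed

lemma sets_\<nu> [measurable_cong, simp]: "sets \<nu> = sets lebesgue"
  by (simp add: \<nu>_def)

lemma space_\<nu> [simp]: "space \<nu> = UNIV"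
  by (simp add: \<nu>_def)

lemma borel_measurable_\<nu>:
  assumes "f \<in> borel_measurable borel"
  shows "f \<in> borel_measurable \<nu>"
proof -
  have "f \<in> borel_measurable lebesgue"
    by (rule measurable_completion) (use assms in simp)
  then show ?thesis
    by (simp only: measurable_cong_sets[OF sets_\<nu> refl])
qed

lemma tail_sets [measurable]: "{z::'a. r \<le> norm z} \<in> sets lebesgue" "{z::'a. norm z < r} \<in> sets lebesgue"
   by (auto intro!: sets_completionI_sets)

lemma emeasure_tail:
  assumes r: "0 < r"
  shows "emeasure \<nu> {z. r \<le> norm z} = ennreal (\<sigma> * M r)"
proof -
  let ?f = "\<lambda>s. \<eta> s * s ^ (DIM('a) - 1)"
  obtain g where g [measurable]: "g \<in> borel_measurable borel"
    and ae1: "AE s in lborel. indicator {0<..} s * \<eta> s = g s"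
    and ae: "AE z in lborel. J z = g (norm z)"
    using ex_borel_profile by blast
  have "emeasure \<nu> {z. r \<le> norm z} = (\<integral>\<^sup>+z. ennreal (J z) * indicator {z. r \<le> norm z} z \<partial>lebesgue)"
    unfolding \<nu>_def by (rule emeasure_density) auto
  also have "\<dots> = (\<integral>\<^sup>+z. ennreal (g (norm z)) * indicator {r..} (norm z) \<partial>(lebesgue :: 'a measure))"
    by (intro nn_integral_cong_AE AE_completion eventually_mono[OF ae]) (auto simp: indicator_def)
  also have "\<dots> = (\<integral>\<^sup>+z. ennreal (g (norm z)) * indicator {r..} (norm z) \<partial>(lborel :: 'a measure))"
    by (rule nn_integral_completion)
  also have "\<dots> = (\<integral>\<^sup>+s. ennreal (\<sigma> * s ^ (DIM('a) - 1)) * indicator {0..} s * (ennreal (g s) * indicator {r..} s) \<partial>lborel)"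
    unfolding \<sigma>_eq by (rule nn_integral_norm) measurable
  also have "\<dots> = (\<integral>\<^sup>+s. ennreal (\<sigma> * s ^ (DIM('a) - 1)) * indicator {0..} s * (ennreal (g s) * indicator {r..} s) \<partial>lebesgue)"
    by (rule nn_integral_completion[symmetric])
  also have "\<dots> = (\<integral>\<^sup>+s. ennreal (\<sigma> * (indicator {r..} s *\<^sub>R ?f s)) \<partial>lebesgue)"
  proof (intro nn_integral_cong_AE AE_completion eventually_mono[OF ae1])
    fix s :: real assume *: "indicator {0<..} s * \<eta> s = g s"
    show "ennreal (\<sigma> * s ^ (DIM('a) - 1)) * indicator {0..} s * (ennreal (g s) * indicator {r..} s) =
      ennreal (\<sigma> * (indicator {r..} s *\<^sub>R ?f s))"
    proof (cases "r \<le> s")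
      case True
      with * r have "g s = \<eta> s" "0 < s" by auto
      then show ?thesis using True \<sigma>_pos nonneg[of s] by (simp add: ennreal_mult' [symmetric] mult_ac)
    qed simp
  qed
  also have "\<dots> = ennreal (\<integral>s. \<sigma> * (indicator {r..} s *\<^sub>R ?f s) \<partial>lebesgue)"
  proof (rule nn_integral_eq_integral)
    show "integrable lebesgue (\<lambda>s. \<sigma> * (indicator {r..} s *\<^sub>R ?f s))"
      using tail_integrable[OF r] unfolding set_integrable_def by (rule integrable_mult_right)
    show "AE s in lebesgue. 0 \<le> \<sigma> * (indicator {r..} s *\<^sub>R ?f s)"
      using r nonneg \<sigma>_pos by (auto simp: indicator_def)
  qed
  also have "\<dots> = ennreal (\<sigma> * M r)"
    by (simp add: M_def set_lebesgue_integral_def)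
  finally show ?thesis .
qed

end

section \<open>Cost of displacing one particle\<close>

lemma powr_le_linear:
  fixes X b :: real
  assumes "0 < X" "0 \<le> b" "b \<le> 1"
  shows "X powr b \<le> 1 + b * (X - 1)"
  using Youngs_inequality_0[of b "1 - b" X 1] assms by (simp add: algebra_simps)

text \<open>
  The scaling assumptions in the form in which they are used, on radii up to \<open>R\<close>. The
  radius \<open>\<rho>\<close> is so small that at least half of the jumps longer than \<open>\<rho>\<close> are shorter
  than \<open>R / 2\<close>.
\<close>

locale critical_profile = radial_profile \<eta> M \<sigma> J
  for \<eta> M :: "real \<Rightarrow> real" and \<sigma> :: real and J :: "'a::euclidean_space \<Rightarrow> real" +
  fixes R \<rho> :: real
  assumes R_le_1: "R \<le> 1"
    and sqrt_growth: "0 < r \<Longrightarrow> r \<le> s \<Longrightarrow> s \<le> R \<Longrightarrow> sqrt r * M r \<le> sqrt s * M s"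
    and doubling: "0 < s \<Longrightarrow> s \<le> s' \<Longrightarrow> s' \<le> 2 * s \<Longrightarrow> s' \<le> R \<Longrightarrow> \<eta> s \<le> 2 ^ (DIM('a) + 1) * \<eta> s'"
    and \<rho>_pos: "0 < \<rho>" and \<rho>_le: "2 * \<rho> \<le> R"
    and M_\<rho>: "2 * M (R / 2) \<le> M \<rho>" and M_\<rho>_pos: "0 < M \<rho>"
begin

text \<open>
  Beyond \<open>R\<close> nothing is known about the scaling of \<open>M\<close>, which may even vanish there. Freezing it at
  \<open>\<rho>\<close> keeps the barrier finite and changes it only where the trivial bound is smaller.
\<close>

definition N :: "real \<Rightarrow> real" where
  "N r = M (min r \<rho>)"

text \<open>
  An upper bound, up to the factor \<open>b\<close>, for the relative increase of \<open>N r powr (- b)\<close> when one of two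
  particles at distance \<open>r\<close> jumps by \<open>s\<close>: linear in \<open>s\<close> for short jumps, and a square root
  instead of a logarithm of \<open>N r / N s\<close> for long ones, which is integrable against \<open>\<nu>\<close>.
\<close>

definition Q :: "real \<Rightarrow> real \<Rightarrow> real" where
  "Q r s = (if s < r then s / r else 2 * sqrt (2 * N r / N s))"

lemma N_eq: "r \<le> \<rho> \<Longrightarrow> N r = M r"
  by (simp add: N_def)

lemma N_antimono: "0 < r \<Longrightarrow> r \<le> s \<Longrightarrow> N s \<le> N r"
  unfolding N_def by (rule M_antimono) (use \<rho>_pos in auto)

lemma N_ge: "0 < r \<Longrightarrow> M \<rho> \<le> N r"
  unfolding N_def by (rule M_antimono) (use \<rho>_pos in auto)

lemma N_pos: "0 < r \<Longrightarrow> 0 < N r"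
  using N_ge[of r] M_\<rho>_pos by simp

text \<open>
  \<open>sqrt_growth\<close> survives the truncation at \<open>\<rho>\<close>, and then holds for all radii.
\<close>

lemma N_ratio:
  assumes "0 < r" "r \<le> s"
  shows "N r \<le> sqrt (s / r) * N s"
proof -
  have 1: "sqrt (min r \<rho>) * N r \<le> sqrt (min s \<rho>) * N s"
    unfolding N_def by (rule sqrt_growth) (use assms \<rho>_pos \<rho>_le in auto)
  have 2: "min s \<rho> / min r \<rho> \<le> s / r"
    using assms \<rho>_pos by (auto simp: min_def field_simps)
  have "N r \<le> sqrt (min s \<rho>) * N s / sqrt (min r \<rho>)"
    using 1 assms \<rho>_pos by (simp add: pos_le_divide_eq mult.commute)
  also have "\<dots> = sqrt (min s \<rho> / min r \<rho>) * N s"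
    by (simp add: real_sqrt_divide)
  also have "\<dots> \<le> sqrt (s / r) * N s"
    by (intro mult_right_mono real_sqrt_le_mono 2 less_imp_le[OF N_pos]) (use assms in auto)
  finally show ?thesis .
qed

lemma continuous_on_N: "continuous_on {0<..} N"
  unfolding N_def
  by (rule continuous_on_compose2[OF continuous_on_M]) (auto intro!: continuous_intros \<rho>_pos)

lemma N_norm_measurable:
  assumes "0 < r"
  shows "(\<lambda>z::'a. N (max r (norm z))) \<in> borel_measurable borel"
  by (rule borel_measurable_continuous_onI, rule continuous_on_compose2[OF continuous_on_N])
    (use assms in \<open>auto intro!: continuous_intros\<close>)

lemma Q_nonneg: "0 < r \<Longrightarrow> 0 \<le> s \<Longrightarrow> 0 \<le> Q r s"
  using N_pos[of r] N_pos[of s] by (auto simp: Q_def intro!: mult_nonneg_nonneg divide_nonneg_nonneg)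

text \<open>
  Both ranges of \<open>norm z\<close> use the concavity bound \<open>X powr b \<le> 1 + b * (X - 1)\<close>. A long jump produces a
  ratio \<open>X\<close> up to \<open>2 * N r / N (norm z)\<close>; writing \<open>X powr b = sqrt X powr (2 * b)\<close> first leaves only
  \<open>sqrt X\<close>, whence the restriction \<open>b \<le> 1 / 2\<close>.
\<close>

lemma displacement_cost:
  fixes a z :: 'a
  assumes b: "0 \<le> b" "b \<le> 1 / 2" and a: "a \<noteq> 0" and z: "a + z \<noteq> 0"
  shows "(N (norm a) / N (norm (a + z))) powr b - 1 \<le> b * Q (norm a) (norm z)"
proof -
  define r s where "r = norm a" and "s = norm (a + z)"
  have r: "0 < r" and s: "0 < s" using a z by (auto simp: r_def s_def)
  have sr: "s \<le> r + norm z" unfolding s_def r_def by (rule norm_triangle_ineq)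
  have pos: "0 < N r / N s" using N_pos r s by simp
  consider "s \<le> r" | "r < s" "norm z < r" | "r < s" "r \<le> norm z" by linarith
  then have "(N r / N s) powr b - 1 \<le> b * Q r (norm z)"
  proof cases
    case 1
    then have "N r / N s \<le> 1" using N_antimono[OF s] N_pos[OF s] by (simp add: pos_divide_le_eq)
    then have "(N r / N s) powr b \<le> 1" using b pos by (intro powr_le1) auto
    moreover have "0 \<le> b * Q r (norm z)" using b Q_nonneg[OF r] by simp
    ultimately show ?thesis by linarith
  next
    case 2
    have "N r / N s \<le> sqrt (s / r)"
      using N_ratio[of r s] 2 r N_pos[OF s] by (simp add: pos_divide_le_eq)
    then have "(N r / N s) powr b \<le> sqrt (s / r) powr b"
      by (intro powr_mono2) (use pos b in auto)
    also have "\<dots> \<le> 1 + b * (sqrt (s / r) - 1)"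
      using b r s by (intro powr_le_linear) auto
    also have "\<dots> \<le> 1 + b * (norm z / r)"
    proof -
      have "sqrt (s / r) \<le> s / r"
        using 2 r s by (intro real_le_lsqrt) (auto simp: power2_eq_square field_simps)
      also have "\<dots> \<le> (r + norm z) / r" using sr r by (simp add: divide_right_mono)
      also have "\<dots> = 1 + norm z / r" using r by (simp add: field_simps)
      finally have "sqrt (s / r) - 1 \<le> norm z / r" by simp
      then show ?thesis by (intro add_left_mono mult_left_mono b(1))
    qed
    finally show ?thesis using 2 by (simp add: Q_def)
  next
    case 3
    define X where "X = 2 * N r / N (norm z)"
    have nz: "0 < norm z" using 3 r by linarith
    have X1: "0 < X" using N_pos[OF r] N_pos[OF nz] by (simp add: X_def)
    have "N (norm z) \<le> sqrt 2 * N (2 * norm z)"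
      using N_ratio[of "norm z" "2 * norm z"] nz by simp
    also have "\<dots> \<le> 2 * N (2 * norm z)"
      using N_pos[of "2 * norm z"] nz by (intro mult_right_mono) (auto intro: real_le_lsqrt)
    also have "N (2 * norm z) \<le> N s"
      by (rule N_antimono) (use s sr 3 in auto)
    finally have "N (norm z) \<le> 2 * N s" by simp
    then have "N r / N s \<le> X"
      using N_pos[OF r] N_pos[OF nz] N_pos[OF s] by (simp add: X_def field_simps)
    then have "(N r / N s) powr b \<le> X powr b"
      by (intro powr_mono2) (use pos b in auto)
    also have "X powr b = sqrt X powr (2 * b)"
      using X1 by (simp add: powr_half_sqrt[symmetric] powr_powr)
    also have "\<dots> \<le> 1 + 2 * b * (sqrt X - 1)"
      using b X1 by (intro powr_le_linear) auto
    also have "\<dots> \<le> 1 + b * (2 * sqrt X)"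
      using b by (simp add: algebra_simps)
    finally show ?thesis using 3 by (simp add: Q_def X_def)
  qed
  then show ?thesis by (simp add: r_def s_def)
qed

text \<open>
  Halving \<open>r\<close> costs at most a factor \<open>sqrt 2\<close> in \<open>M\<close>, so passing from the bound at \<open>r / 2\<close> to the one
  at \<open>r\<close> multiplies the constant \<open>c\<close> into \<open>(c / 2 + 1) * sqrt 2\<close>; the value \<open>c = 5\<close> is preserved.
\<close>

lemma first_moment_shells:
  assumes "0 < r" "r \<le> R"
  shows "(\<integral>\<^sup>+z. ennreal (norm z) * indicator {z. r / 2 ^ n \<le> norm z \<and> norm z < r} z \<partial>\<nu>) \<le> ennreal (5 * \<sigma> * r * M r)"
  using assms
proof (induction n arbitrary: r)
  case 0
  have *: "{z::'a. r / 2 ^ 0 \<le> norm z \<and> norm z < r} = {}" by auto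
  show ?case unfolding * by simp
next
  case (Suc n)
  have [measurable]: "(\<lambda>z::'a. ennreal (norm z) * indicator {z. r / 2 / 2 ^ n \<le> norm z \<and> norm z < r / 2} z) \<in> borel_measurable \<nu>"
    "(\<lambda>z::'a. ennreal r * indicator {z. r / 2 \<le> norm z} z) \<in> borel_measurable \<nu>"
    by (intro borel_measurable_\<nu>; measurable)+
  have "(\<integral>\<^sup>+z. ennreal (norm z) * indicator {z. r / 2 ^ Suc n \<le> norm z \<and> norm z < r} z \<partial>\<nu>) \<le>
    (\<integral>\<^sup>+z. ennreal (norm z) * indicator {z. r / 2 / 2 ^ n \<le> norm z \<and> norm z < r / 2} z +
       ennreal r * indicator {z. r / 2 \<le> norm z} z \<partial>\<nu>)"
    by (intro nn_integral_mono) (auto simp: indicator_def)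
  also have "\<dots> = (\<integral>\<^sup>+z. ennreal (norm z) * indicator {z. r / 2 / 2 ^ n \<le> norm z \<and> norm z < r / 2} z \<partial>\<nu>) +
    (\<integral>\<^sup>+z. ennreal r * indicator {z. r / 2 \<le> norm z} z \<partial>\<nu>)"
    by (rule nn_integral_add) fact+
  also have "(\<integral>\<^sup>+z. ennreal r * indicator {z. r / 2 \<le> norm z} z \<partial>\<nu>) = ennreal r * ennreal (\<sigma> * M (r / 2))"
    using Suc.prems emeasure_tail[of "r / 2"] by (subst nn_integral_cmult_indicator) auto
  also have "(\<integral>\<^sup>+z. ennreal (norm z) * indicator {z. r / 2 / 2 ^ n \<le> norm z \<and> norm z < r / 2} z \<partial>\<nu>) \<le>
    ennreal (5 * \<sigma> * (r / 2) * M (r / 2))"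
    by (rule Suc.IH) (use Suc.prems in auto)
  also have "ennreal (5 * \<sigma> * (r / 2) * M (r / 2)) + ennreal r * ennreal (\<sigma> * M (r / 2)) =
    ennreal (7 / 2 * \<sigma> * r * M (r / 2))"
    using Suc.prems \<sigma>_pos M_nonneg[of "r / 2"]
    by (simp add: ennreal_mult' [symmetric] ennreal_plus[symmetric] del: ennreal_plus)
  also have "\<dots> \<le> ennreal (5 * \<sigma> * r * M r)"
  proof (rule ennreal_leI)
    have "sqrt (r / 2) * M (r / 2) \<le> sqrt r * M r"
      by (rule sqrt_growth) (use Suc.prems in auto)
    then have "M (r / 2) \<le> sqrt 2 * M r"
      using Suc.prems by (simp add: real_sqrt_divide field_simps)
    also have "\<dots> \<le> 10 / 7 * M r"
      using M_nonneg[of r] Suc.prems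
      by (intro mult_right_mono real_le_lsqrt) (auto simp: power2_eq_square)
    finally have *: "7 / 2 * M (r / 2) \<le> 5 * M r" by simp
    have "7 / 2 * \<sigma> * r * M (r / 2) = \<sigma> * r * (7 / 2 * M (r / 2))" by simp
    also have "\<dots> \<le> \<sigma> * r * (5 * M r)"
      using * Suc.prems \<sigma>_pos by (intro mult_left_mono) auto
    finally show "7 / 2 * \<sigma> * r * M (r / 2) \<le> 5 * \<sigma> * r * M r" by (simp add: mult_ac)
  qed
  finally show ?case by (simp add: add_right_mono)
qed

lemma first_moment:
  assumes "0 < r" "r \<le> R"
  shows "(\<integral>\<^sup>+z. ennreal (norm z) * indicator {z. norm z < r} z \<partial>\<nu>) \<le> ennreal (5 * \<sigma> * r * M r)"
proof -
  let ?f = "\<lambda>n z::'a. ennreal (norm z) * indicator {z. r / 2 ^ n \<le> norm z \<and> norm z < r} z"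
  have m: "?f n \<in> borel_measurable \<nu>" for n
    by (intro borel_measurable_\<nu>) measurable
  have inc: "incseq ?f"
  proof (intro incseq_SucI le_funI)
    fix n and z :: 'a
    have "r / 2 ^ Suc n \<le> r / 2 ^ n"
      using assms by (simp add: field_simps)
    then show "?f n z \<le> ?f (Suc n) z"
      by (auto simp: indicator_def simp del: power_Suc)
  qed
  have "(\<integral>\<^sup>+z. ennreal (norm z) * indicator {z. norm z < r} z \<partial>\<nu>) \<le> (\<integral>\<^sup>+z. (SUP n. ?f n z) \<partial>\<nu>)"
  proof (rule nn_integral_mono)
    fix z :: 'a
    show "ennreal (norm z) * indicator {z. norm z < r} z \<le> (SUP n. ?f n z)"
    proof (cases "z = 0")
      case False
      then obtain n where "r / norm z < 2 ^ n"
        using real_arch_pow[of 2 "r / norm z"] by auto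
      then have "r / 2 ^ n \<le> norm z" using False by (simp add: field_simps)
      then show ?thesis by (intro SUP_upper2[of n]) (auto simp: indicator_def)
    qed simp
  qed
  also have "\<dots> = (SUP n. \<integral>\<^sup>+z. ?f n z \<partial>\<nu>)"
    by (rule nn_integral_monotone_convergence_SUP[OF inc m])
  also have "\<dots> \<le> ennreal (5 * \<sigma> * r * M r)"
    by (intro SUP_least first_moment_shells assms)
  finally show ?thesis .
qed

text \<open>
  This is the inequality \<open>\<integral> N powr (- 1 / 2) d(- M) \<le> 4 * sqrt (M r)\<close>. Instead of a change of
  variables, cut at the radius \<open>s\<close> where \<open>M\<close> has dropped to a quarter: between \<open>r\<close> and \<open>s\<close>
  the integrand is at most \<open>2 / sqrt (M r)\<close>, which contributes \<open>2 * sqrt (M r)\<close>, and the rest is the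
  same integral with \<open>sqrt (M s) = sqrt (M r) / 2\<close>.
\<close>

lemma tail_moment:
  assumes "0 < r" "r \<le> \<rho>"
  shows "(\<integral>\<^sup>+z. ennreal (1 / sqrt (N (norm z))) * indicator {z. r \<le> norm z} z \<partial>\<nu>) \<le> ennreal (4 * \<sigma> * sqrt (M r))"
proof -
  have near: "ennreal (1 / sqrt (N (norm z))) \<le> ennreal (2 / sqrt (M r))"
    if "0 < r" "0 < norm z" "0 < M r" "M r \<le> 4 * N (norm z)" for r and z :: 'a
  proof (rule ennreal_leI)
    have "sqrt (M r) \<le> sqrt (2\<^sup>2 * N (norm z))" using that by (intro real_sqrt_le_mono) auto
    also have "\<dots> = 2 * sqrt (N (norm z))" by (simp add: real_sqrt_mult)
    finally show "1 / sqrt (N (norm z)) \<le> 2 / sqrt (M r)"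
      using that N_pos[of "norm z"] by (simp add: field_simps)
  qed
  have tail: "ennreal (2 / sqrt (M r)) * emeasure \<nu> {z. r \<le> norm z} = ennreal (2 * \<sigma> * sqrt (M r))"
    if "0 < r" "0 < M r" for r
  proof -
    have "2 / sqrt (M r) * (\<sigma> * M r) = 2 * \<sigma> * sqrt (M r)"
      using that by (simp add: real_div_sqrt field_simps)
    then show ?thesis
      using that \<sigma>_pos by (simp add: emeasure_tail ennreal_mult' [symmetric])
  qed
  have tail_meas: "(\<integral>\<^sup>+z. ennreal c * indicator {z. r \<le> norm z} z \<partial>\<nu>) = ennreal c * emeasure \<nu> {z. r \<le> norm z}" for c r
    by (rule nn_integral_cmult_indicator) simp
  \<comment> \<open>Induction on the number of quarterings until \<open>M \<rho>\<close> is reached; beyond \<open>\<rho>\<close> the function \<open>N\<close> is constant.\<close>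
  have "(\<integral>\<^sup>+z. ennreal (1 / sqrt (N (norm z))) * indicator {z. r \<le> norm z} z \<partial>\<nu>) \<le> ennreal (4 * \<sigma> * sqrt (M r))"
    if "M r \<le> 4 ^ Suc n * M \<rho>" for n
    using that assms
  proof (induction n arbitrary: r)
    case 0
    have Mr: "0 < M r" using M_antimono[of r \<rho>] 0 M_\<rho>_pos by simp
    have "(\<integral>\<^sup>+z. ennreal (1 / sqrt (N (norm z))) * indicator {z. r \<le> norm z} z \<partial>\<nu>) \<le>
      (\<integral>\<^sup>+z. ennreal (2 / sqrt (M r)) * indicator {z. r \<le> norm z} z \<partial>\<nu>)"
    proof (rule nn_integral_mono)
      fix z :: 'a
      show "ennreal (1 / sqrt (N (norm z))) * indicator {z. r \<le> norm z} z \<le>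
        ennreal (2 / sqrt (M r)) * indicator {z. r \<le> norm z} z"
        using near[of r z] N_ge[of "norm z"] 0 Mr
        by (cases "r \<le> norm z"; cases "z = 0") (auto simp: indicator_def)
    qed
    also have "\<dots> = ennreal (2 * \<sigma> * sqrt (M r))"
      using tail_meas tail 0 Mr by simp
    also have "\<dots> \<le> ennreal (4 * \<sigma> * sqrt (M r))"
      using \<sigma>_pos Mr by (intro ennreal_leI) auto
    finally show ?case .
  next
    case (Suc n)
    have Mr: "0 < M r" using M_antimono[of r \<rho>] Suc.prems M_\<rho>_pos by simp
    obtain s where s: "r \<le> s" "s \<le> \<rho>" "M r \<le> 4 * M s" "M s \<le> 4 ^ Suc n * M \<rho>" "M s = M r / 4 \<or> s = \<rho>"
    proof (cases "M r / 4 \<ge> M \<rho>")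
      case True
      have "\<exists>s\<ge>r. s \<le> \<rho> \<and> M s = M r / 4"
        by (rule IVT2') (use True Suc.prems Mr in \<open>auto intro: continuous_on_subset[OF continuous_on_M]\<close>)
      then obtain s where "r \<le> s" "s \<le> \<rho>" "M s = M r / 4" by auto
      then show ?thesis using Suc.prems by (intro that[of s]) auto
    next
      case False
      have "1 * M \<rho> \<le> 4 ^ Suc n * M \<rho>"
        using M_\<rho>_pos by (intro mult_right_mono one_le_power) auto
      then show ?thesis using False Suc.prems by (intro that[of \<rho>]) auto
    qed
    show ?case
    proof (cases "M s = M r / 4")
      case False
      then have "s = \<rho>" using s by simp
      then have "M r \<le> 4 * M \<rho>" using s by simp
      moreover have "1 * (4 * M \<rho>) \<le> 4 ^ n * (4 * M \<rho>)"
        using M_\<rho>_pos by (intro mult_right_mono one_le_power) auto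
      ultimately have "M r \<le> 4 ^ Suc n * M \<rho>"
        unfolding power_Suc by linarith
      then show ?thesis using Suc by blast
    next
      case True
      have s0: "0 < s" using s Suc.prems by simp
      have [measurable]: "(\<lambda>z::'a. ennreal (2 / sqrt (M r)) * indicator {z. r \<le> norm z} z) \<in> borel_measurable \<nu>"
        by (intro borel_measurable_\<nu>) measurable
      note N_norm_measurable[OF s0, measurable]
      have "(\<lambda>z::'a. ennreal (1 / sqrt (N (max s (norm z)))) * indicator {z. s \<le> norm z} z) \<in> borel_measurable \<nu>"
        by (intro borel_measurable_\<nu>) measurable
      also have "(\<lambda>z::'a. ennreal (1 / sqrt (N (max s (norm z)))) * indicator {z. s \<le> norm z} z) =
        (\<lambda>z::'a. ennreal (1 / sqrt (N (norm z))) * indicator {z. s \<le> norm z} z)"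
        by (auto simp: indicator_def fun_eq_iff max_def)
      finally have [measurable]: "(\<lambda>z::'a. ennreal (1 / sqrt (N (norm z))) * indicator {z. s \<le> norm z} z) \<in> borel_measurable \<nu>" .
      have "(\<integral>\<^sup>+z. ennreal (1 / sqrt (N (norm z))) * indicator {z. r \<le> norm z} z \<partial>\<nu>) \<le>
        (\<integral>\<^sup>+z. ennreal (2 / sqrt (M r)) * indicator {z. r \<le> norm z} z +
           ennreal (1 / sqrt (N (norm z))) * indicator {z. s \<le> norm z} z \<partial>\<nu>)"
      proof (rule nn_integral_mono)
        fix z :: 'a
        have "ennreal (1 / sqrt (N (norm z))) \<le> ennreal (2 / sqrt (M r))" if "r \<le> norm z" "norm z < s"
        proof (rule near)
          show "M r \<le> 4 * N (norm z)"
            using that s N_antimono[of "norm z" s] Suc.prems N_eq[of s] by (cases "z = 0") auto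
        qed (use that Suc.prems Mr in auto)
        then show "ennreal (1 / sqrt (N (norm z))) * indicator {z. r \<le> norm z} z \<le>
          ennreal (2 / sqrt (M r)) * indicator {z. r \<le> norm z} z +
           ennreal (1 / sqrt (N (norm z))) * indicator {z. s \<le> norm z} z"
          using s by (auto simp: indicator_def)
      qed
      also have "\<dots> = ennreal (2 * \<sigma> * sqrt (M r)) +
        (\<integral>\<^sup>+z. ennreal (1 / sqrt (N (norm z))) * indicator {z. s \<le> norm z} z \<partial>\<nu>)"
        using tail_meas tail Suc.prems Mr by (subst nn_integral_add) auto
      also have "\<dots> \<le> ennreal (2 * \<sigma> * sqrt (M r)) + ennreal (4 * \<sigma> * sqrt (M s))"
        using Suc.IH[of s] s s0 by (intro add_left_mono) auto
      also have "\<dots> = ennreal (4 * \<sigma> * sqrt (M r))"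
      proof -
        have "sqrt (M s) = sqrt (M r) / 2"
          unfolding True by (simp add: real_sqrt_divide)
        then have "2 * \<sigma> * sqrt (M r) + 4 * \<sigma> * sqrt (M s) = 4 * \<sigma> * sqrt (M r)"
          by simp
        moreover have "0 \<le> 2 * \<sigma> * sqrt (M r)" "0 \<le> 4 * \<sigma> * sqrt (M s)"
          using \<sigma>_pos Mr True by auto
        ultimately show ?thesis
          by (metis ennreal_plus)
      qed
      finally show ?thesis .
    qed
  qed
  moreover obtain n where "M r \<le> 4 ^ Suc n * M \<rho>"
  proof -
    obtain n where "M r / M \<rho> < 4 ^ n" using real_arch_pow[of 4 "M r / M \<rho>"] by auto
    also have "(4::real) ^ n \<le> 4 ^ Suc n" by simp
    finally have "M r \<le> 4 ^ Suc n * M \<rho>" using M_\<rho>_pos by (simp add: pos_divide_less_eq)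
    then show ?thesis by (rule that)
  qed
  ultimately show ?thesis by blast
qed

lemma Q_measurable:
  assumes "0 < r"
  shows "(\<lambda>z::'a. Q r (norm z)) \<in> borel_measurable borel"
proof -
  have "(\<lambda>z::'a. if norm z < r then norm z / r else 2 * sqrt (2 * N r / N (max r (norm z)))) \<in> borel_measurable borel"
    using N_norm_measurable[OF assms] by measurable
  also have "(\<lambda>z::'a. if norm z < r then norm z / r else 2 * sqrt (2 * N r / N (max r (norm z)))) =
    (\<lambda>z::'a. Q r (norm z))"
    by (auto simp: Q_def fun_eq_iff max_def)
  finally show ?thesis .
qed

lemma displacement_cost_integral:
  assumes r: "0 < r" "r \<le> \<rho>"
  shows "(\<integral>\<^sup>+z. ennreal (Q r (norm z)) \<partial>\<nu>) \<le> ennreal (17 * \<sigma> * M r)"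
proof -
  have Mr: "0 < M r" using M_antimono[of r \<rho>] r M_\<rho>_pos by simp
  define c where "c = 2 * sqrt (2 * M r)"
  have c0: "0 \<le> c" using Mr by (simp add: c_def)
  have m1: "(\<lambda>z::'a. ennreal (norm z) * indicator {z. norm z < r} z) \<in> borel_measurable \<nu>"
    by (intro borel_measurable_\<nu>) measurable
  note N_norm_measurable[OF r(1), measurable]
  have "(\<lambda>z::'a. ennreal (1 / sqrt (N (max r (norm z)))) * indicator {z. r \<le> norm z} z) \<in> borel_measurable \<nu>"
    by (intro borel_measurable_\<nu>) measurable
  also have "(\<lambda>z::'a. ennreal (1 / sqrt (N (max r (norm z)))) * indicator {z. r \<le> norm z} z) =
    (\<lambda>z::'a. ennreal (1 / sqrt (N (norm z))) * indicator {z. r \<le> norm z} z)"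
    by (auto simp: indicator_def fun_eq_iff max_def)
  finally have m2: "(\<lambda>z::'a. ennreal (1 / sqrt (N (norm z))) * indicator {z. r \<le> norm z} z) \<in> borel_measurable \<nu>" .
  have "ennreal (Q r (norm z)) = ennreal (1 / r) * (ennreal (norm z) * indicator {z. norm z < r} z) +
    ennreal c * (ennreal (1 / sqrt (N (norm z))) * indicator {z. r \<le> norm z} z)" for z :: 'a
    using r c0 N_eq[of r]
    by (auto simp: Q_def c_def indicator_def ennreal_mult' [symmetric] real_sqrt_divide)
  then have "(\<integral>\<^sup>+z. ennreal (Q r (norm z)) \<partial>\<nu>) =
    (\<integral>\<^sup>+z. ennreal (1 / r) * (ennreal (norm z) * indicator {z. norm z < r} z) +
      ennreal c * (ennreal (1 / sqrt (N (norm z))) * indicator {z. r \<le> norm z} z) \<partial>\<nu>)"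
    by simp
  also have "\<dots> = ennreal (1 / r) * (\<integral>\<^sup>+z. ennreal (norm z) * indicator {z. norm z < r} z \<partial>\<nu>) +
    ennreal c * (\<integral>\<^sup>+z. ennreal (1 / sqrt (N (norm z))) * indicator {z. r \<le> norm z} z \<partial>\<nu>)"
    using m1 m2 by (simp add: nn_integral_add nn_integral_cmult)
  also have "\<dots> \<le> ennreal (1 / r) * ennreal (5 * \<sigma> * r * M r) + ennreal c * ennreal (4 * \<sigma> * sqrt (M r))"
    using first_moment[of r] tail_moment[OF r] r \<rho>_le \<rho>_pos by (intro add_mono mult_left_mono) auto
  also have "\<dots> = ennreal (5 * \<sigma> * M r + c * (4 * \<sigma> * sqrt (M r)))"
    using r c0 \<sigma>_pos Mr by (simp add: ennreal_mult' [symmetric] ennreal_plus[symmetric] del: ennreal_plus)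
  also have "\<dots> \<le> ennreal (17 * \<sigma> * M r)"
  proof (rule ennreal_leI)
    have "c * (4 * \<sigma> * sqrt (M r)) = 8 * sqrt 2 * \<sigma> * (sqrt (M r) * sqrt (M r))"
      by (simp add: c_def real_sqrt_mult)
    also have "\<dots> = 8 * sqrt 2 * \<sigma> * M r" using Mr by simp
    also have "\<dots> \<le> 8 * (3 / 2) * \<sigma> * M r"
      using \<sigma>_pos Mr by (intro mult_right_mono mult_left_mono real_le_lsqrt) (auto simp: power2_eq_square)
    finally show "5 * \<sigma> * M r + c * (4 * \<sigma> * sqrt (M r)) \<le> 17 * \<sigma> * M r" by simp
  qed
  finally show ?thesis .
qed

end

section \<open>The nonlocal operator at two nearby points\<close>

text \<open>
  The kernels are only Lebesgue measurable, so the invariances are needed for \<open>lebesgue\<close> and not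
  just for \<open>lborel\<close>.
\<close>

lemma lebesgue_isometry:
  fixes t :: "'a::euclidean_space"
  assumes "\<bar>c\<bar> = 1"
  shows "distr lebesgue lebesgue (\<lambda>x. t + c *\<^sub>R x) = lebesgue"
    and "(\<lambda>x. t + c *\<^sub>R x) \<in> lebesgue \<rightarrow>\<^sub>M lebesgue"
proof -
  have T: "(\<lambda>x. t + (\<Sum>j\<in>Basis. (c * (x \<bullet> j)) *\<^sub>R j)) = (\<lambda>x. t + c *\<^sub>R x)"
    by (simp add: scaleR_scaleR[symmetric] scaleR_sum_right[symmetric] euclidean_representation del: scaleR_scaleR)
  have c: "c \<noteq> 0" using assms by auto
  show "(\<lambda>x. t + c *\<^sub>R x) \<in> lebesgue \<rightarrow>\<^sub>M lebesgue"
    using lebesgue_affine_measurable[of "\<lambda>_. c" t] c unfolding T by simp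
  show "distr lebesgue lebesgue (\<lambda>x. t + c *\<^sub>R x) = lebesgue"
    using lebesgue_affine_euclidean[of "\<lambda>_. c" t] c assms unfolding T by (simp add: density_1)
qed

context radial_profile
begin

lemma emeasure_\<nu>_uminus:
  assumes [measurable]: "A \<in> sets lebesgue"
  shows "emeasure \<nu> (uminus -` A) = emeasure \<nu> A"
proof -
  have T: "distr lebesgue lebesgue uminus = (lebesgue :: 'a measure)"
    and [measurable]: "uminus \<in> lebesgue \<rightarrow>\<^sub>M (lebesgue :: 'a measure)"
    using lebesgue_isometry[of "-1" "0::'a"] by simp_all
  have "uminus -` A \<inter> space lebesgue \<in> sets lebesgue"
    by measurable
  then have "emeasure \<nu> (uminus -` A) = (\<integral>\<^sup>+z. ennreal (J z) * indicator (uminus -` A) z \<partial>lebesgue)"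
    unfolding \<nu>_def by (subst emeasure_density) auto
  also have "\<dots> = (\<integral>\<^sup>+z. ennreal (J (- z)) * indicator A (- z) \<partial>lebesgue)"
    by (intro nn_integral_cong) (simp add: J_def indicator_def)
  also have "\<dots> = (\<integral>\<^sup>+z. ennreal (J z) * indicator A z \<partial>distr lebesgue lebesgue uminus)"
    by (subst nn_integral_distr) auto
  also have "\<dots> = emeasure \<nu> A"
    unfolding T \<nu>_def by (subst emeasure_density) auto
  finally show ?thesis .
qed

lemma integral_\<nu>:
  fixes f :: "'a \<Rightarrow> real"
  assumes "f \<in> borel_measurable lebesgue"
  shows "integral\<^sup>L \<nu> f = (\<integral>z. f z * J z \<partial>lebesgue)"
    and "integrable \<nu> f \<longleftrightarrow> integrable lebesgue (\<lambda>z. f z * J z)"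
  using integral_density[OF assms J_measurable] integrable_density[OF assms J_measurable]
  by (simp_all add: \<nu>_def J_nonneg mult.commute)

end

context critical_profile
begin

text \<open>
  Landing points, relative to the particle at \<open>y\<close>, that both particles may use when \<open>a = x - y\<close>. The
  half-space condition says that they are not closer to \<open>x\<close> than to \<open>y\<close>, and with \<open>norm a \<le> norm w\<close>
  the two distances differ by at most a factor \<open>2\<close>.
\<close>

definition shared_targets :: "'a \<Rightarrow> 'a set" where
  "shared_targets a = {w. norm a \<le> norm w \<and> norm w < R / 2 \<and> w \<bullet> a \<le> 0}"

lemma shared_targets_measurable [measurable]: "shared_targets a \<in> sets lebesgue"
  by (rule sets_completionI_sets) (simp add: shared_targets_def)

lemma J_shared_targets:
  assumes "a \<noteq> 0" "w \<in> shared_targets a"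
  shows "J w \<le> 2 ^ (DIM('a) + 1) * J (w - a)"
proof -
  have w: "0 < norm w" "norm a \<le> norm w" "norm w < R / 2" "w \<bullet> a \<le> 0"
    using assms by (auto simp: shared_targets_def)
  have "(norm w)\<^sup>2 \<le> (norm (w - a))\<^sup>2"
  proof -
    have "(norm (w - a))\<^sup>2 = (norm w)\<^sup>2 + (norm a)\<^sup>2 - 2 * (w \<bullet> a)"
      by (simp add: power2_norm_eq_inner inner_diff inner_commute)
    then show ?thesis
      using w(4) zero_le_power2[of "norm a"] by linarith
  qed
  then have 1: "norm w \<le> norm (w - a)"
    by (rule power2_le_imp_le) simp
  have 2: "norm (w - a) \<le> 2 * norm w"
    using norm_triangle_ineq4[of w a] w by linarith
  have "\<eta> (norm w) \<le> 2 ^ (DIM('a) + 1) * \<eta> (norm (w - a))"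
    by (rule doubling) (use w 1 2 in linarith)+
  moreover have "w \<noteq> 0" "w - a \<noteq> 0" using w 1 by auto
  ultimately show ?thesis by (simp add: J_def)
qed

text \<open>
  The set and its reflection cover the annulus between \<open>norm a\<close> and \<open>R / 2\<close>, and \<open>\<nu>\<close> is even. At least
  half of the mass outside radius \<open>norm a\<close> lies in that annulus.
\<close>

lemma emeasure_\<nu>_shared_targets:
  assumes a: "a \<noteq> 0" "norm a \<le> \<rho>"
  shows "ennreal (\<sigma> * M (norm a) / 4) \<le> emeasure \<nu> (shared_targets a)"
    and "emeasure \<nu> (shared_targets a) < \<infinity>"
proof -
  let ?H = "shared_targets a" and ?A = "{w::'a. norm a \<le> norm w \<and> norm w < R / 2}"
  have Rp: "0 < R / 2" and r: "0 < norm a" using \<rho>_pos \<rho>_le a by auto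
  have [measurable]: "?A \<in> sets lebesgue"
    by (rule sets_completionI_sets) simp
  have "emeasure \<nu> ?H \<le> emeasure \<nu> {w. norm a \<le> norm w}"
    by (rule emeasure_mono) (auto simp: shared_targets_def)
  also have "\<dots> = ennreal (\<sigma> * M (norm a))"
    by (rule emeasure_tail) (use a in auto)
  finally show fin: "emeasure \<nu> ?H < \<infinity>"
    using order_le_less_trans by fastforce
  have "uminus -` ?H = {w. norm a \<le> norm w \<and> norm w < R / 2 \<and> 0 \<le> w \<bullet> a}"
    by (auto simp: shared_targets_def)
  then have A: "?A \<subseteq> ?H \<union> uminus -` ?H"
    by (auto simp: shared_targets_def)
  have [measurable]: "uminus -` ?H \<in> sets lebesgue"
    by (rule sets_completionI_sets) (simp add: shared_targets_def)
  have "ennreal (\<sigma> * M (norm a)) = emeasure \<nu> {w. norm a \<le> norm w}"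
    by (rule emeasure_tail[symmetric, OF r])
  also have "\<dots> \<le> emeasure \<nu> (?A \<union> {w. R / 2 \<le> norm w})"
    by (rule emeasure_mono) auto
  also have "\<dots> \<le> emeasure \<nu> ?A + emeasure \<nu> {w. R / 2 \<le> norm w}"
    by (rule emeasure_subadditive) auto
  also have "emeasure \<nu> ?A \<le> emeasure \<nu> (?H \<union> uminus -` ?H)"
    by (rule emeasure_mono[OF A]) auto
  also have "\<dots> \<le> emeasure \<nu> ?H + emeasure \<nu> (uminus -` ?H)"
    by (rule emeasure_subadditive) auto
  also have "emeasure \<nu> (uminus -` ?H) = emeasure \<nu> ?H"
    by (rule emeasure_\<nu>_uminus) simp
  also have "emeasure \<nu> {w. R / 2 \<le> norm w} = ennreal (\<sigma> * M (R / 2))"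
    by (rule emeasure_tail[OF Rp])
  finally have *: "ennreal (\<sigma> * M (norm a)) \<le> emeasure \<nu> ?H + emeasure \<nu> ?H + ennreal (\<sigma> * M (R / 2))"
    by (simp add: add_right_mono)
  obtain h where h: "0 \<le> h" "emeasure \<nu> ?H = ennreal h"
    using fin by (cases "emeasure \<nu> ?H") auto
  have MR: "0 \<le> M (R / 2)" by (rule M_nonneg[OF Rp])
  have "\<sigma> * M (norm a) \<le> h + h + \<sigma> * M (R / 2)"
    using * h MR \<sigma>_pos by (simp add: ennreal_plus[symmetric] del: ennreal_plus)
  moreover have "2 * M (R / 2) \<le> M (norm a)"
    using M_\<rho> M_antimono[of "norm a" \<rho>] a by simp
  then have "\<sigma> * (2 * M (R / 2)) \<le> \<sigma> * M (norm a)"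
    using \<sigma>_pos by (intro mult_left_mono) auto
  ultimately have "\<sigma> * M (norm a) / 4 \<le> h" by simp
  then show "ennreal (\<sigma> * M (norm a) / 4) \<le> emeasure \<nu> ?H"
    unfolding h(2) by (rule ennreal_leI)
qed

lemma Q_integral:
  assumes r: "0 < r" "r \<le> \<rho>"
  shows "integrable \<nu> (\<lambda>z. Q r (norm z))" and "(\<integral>z. Q r (norm z) \<partial>\<nu>) \<le> 17 * \<sigma> * M r"
proof -
  have m: "(\<lambda>z. Q r (norm z)) \<in> borel_measurable \<nu>"
    by (rule borel_measurable_\<nu>[OF Q_measurable[OF r(1)]])
  show i: "integrable \<nu> (\<lambda>z. Q r (norm z))"
  proof (rule integrableI_nonneg[OF m])
    show "(\<integral>\<^sup>+z. ennreal (Q r (norm z)) \<partial>\<nu>) < \<infinity>"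
      using displacement_cost_integral[OF r] order_le_less_trans by fastforce
  qed (use Q_nonneg[OF r(1)] in auto)
  have "ennreal (\<integral>z. Q r (norm z) \<partial>\<nu>) \<le> ennreal (17 * \<sigma> * M r)"
    using nn_integral_eq_integral[OF i] displacement_cost_integral[OF r] Q_nonneg[OF r(1)] by simp
  moreover have "0 \<le> 17 * \<sigma> * M r"
    using M_nonneg[OF r(1)] \<sigma>_pos by simp
  ultimately show "(\<integral>z. Q r (norm z) \<partial>\<nu>) \<le> 17 * \<sigma> * M r"
    by (simp add: ennreal_le_iff)
qed

text \<open>
  The coalescence estimate. The hypotheses \<open>h1\<close> and \<open>h2\<close> say how much \<open>u x - u y\<close> can increase when only
  one point is moved. With both integrals written over the common landing point \<open>y + w\<close>, a multiple
  \<open>\<mu>\<close> of \<open>J w\<close> on the shared targets is split off from both kernels: there \<open>u (y + w)\<close> cancels and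
  \<open>- \<mu> * (u x - u y)\<close> remains. The nonnegative rests of the kernels are paired with the nonnegative
  bounds from \<open>h1\<close> and \<open>h2\<close>, so no cancellation is needed in them.
\<close>

lemma nonlocal_difference_le:
  fixes u k1 k2 P :: "'a \<Rightarrow> real" and x y :: 'a
  assumes a: "x \<noteq> y" "norm (x - y) \<le> \<rho>" and C: "0 < C"
    and k1: "\<And>z. z \<noteq> 0 \<Longrightarrow> 1 / C * J z \<le> k1 z \<and> k1 z \<le> C * J z"
    and k2: "\<And>z. z \<noteq> 0 \<Longrightarrow> 1 / C * J z \<le> k2 z \<and> k2 z \<le> C * J z"
    and int1: "integrable lebesgue (\<lambda>z. (u x - u (x + z)) * k1 z)"
    and int2: "integrable lebesgue (\<lambda>z. (u y - u (y + z)) * k2 z)"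
    and b: "0 \<le> b" "b \<le> 1 / 2" and \<Phi>: "0 \<le> \<Phi>" "\<Phi> \<le> u x - u y"
    and P: "integrable \<nu> P" "\<And>z. 0 \<le> P z"
    and h1: "\<And>z. x + z \<noteq> y \<Longrightarrow>
      u (x + z) - u x \<le> \<Phi> * ((N (norm (x - y)) / N (norm (x + z - y))) powr b - 1) + P z"
    and h2: "\<And>z. x \<noteq> y + z \<Longrightarrow>
      u y - u (y + z) \<le> \<Phi> * ((N (norm (x - y)) / N (norm (x - (y + z)))) powr b - 1)"
  shows "(\<integral>z. (u y - u (y + z)) * k2 z \<partial>lebesgue) - (\<integral>z. (u x - u (x + z)) * k1 z \<partial>lebesgue)
    \<le> C * integral\<^sup>L \<nu> P + \<sigma> * M (norm (x - y)) * \<Phi> * (34 * C * b - 1 / (C * 2 ^ (DIM('a) + 3)))"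
proof -
  define a where "a = x - y"
  define r where "r = norm a"
  have a0: "a \<noteq> 0" and r0: "0 < r" "r \<le> \<rho>" using assms by (auto simp: a_def r_def)
  define c where "c = 1 / (C * 2 ^ (DIM('a) + 1))"
  have c0: "0 < c" using C by (simp add: c_def)
  define f1 where "f1 z = - ((u x - u (x + z)) * k1 z)" for z
  define f2 where "f2 z = (u y - u (y + z)) * k2 z" for z
  define g1 where "g1 z = C * ((\<Phi> * b * Q r (norm z) + P z) * J z)" for z
  define g2 where "g2 z = C * ((\<Phi> * b * Q r (norm z)) * J z)" for z
  define m where "m w = \<Phi> * c * (indicator (shared_targets a) w * J w)" for w
  \<comment> \<open>\<open>S\<close> turns a displacement from \<open>y\<close> into the displacement from \<open>x\<close> to the same landing point.\<close>
  define S where "S w = (- a) + 1 *\<^sub>R w" for w :: 'a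
  have S: "distr lebesgue lebesgue S = lebesgue" "S \<in> lebesgue \<rightarrow>\<^sub>M lebesgue"
    unfolding S_def[abs_def] by (intro lebesgue_isometry; simp)+
  have shift: "integrable lebesgue (\<lambda>w. f (S w))" "(\<integral>w. f (S w) \<partial>lebesgue) = integral\<^sup>L lebesgue f"
    if "integrable lebesgue f" for f :: "'a \<Rightarrow> real"
    using integrable_distr_eq[OF S(2), of f] integral_distr[OF S(2), of f] that
    by (auto simp: S(1) dest: borel_measurable_integrable)
  have Qm: "(\<lambda>z::'a. Q r (norm z)) \<in> borel_measurable lebesgue"
    using measurable_completion[of _ lborel] Q_measurable[OF r0(1)] by simp
  have Pm: "P \<in> borel_measurable lebesgue"
    using P(1) by (auto dest: borel_measurable_integrable simp: measurable_cong_sets[OF sets_\<nu> refl])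
  have g1m: "integrable \<nu> (\<lambda>z. \<Phi> * b * Q r (norm z) + P z)"
    and g2m: "integrable \<nu> (\<lambda>z. \<Phi> * b * Q r (norm z))"
    using Q_integral(1)[OF r0] P(1) by auto
  have g1: "integrable lebesgue g1" "integral\<^sup>L lebesgue g1 = C * (\<integral>z. \<Phi> * b * Q r (norm z) + P z \<partial>\<nu>)"
    unfolding g1_def using g1m integral_\<nu>[of "\<lambda>z. \<Phi> * b * Q r (norm z) + P z"] Qm Pm by auto
  have g2: "integrable lebesgue g2" "integral\<^sup>L lebesgue g2 = C * (\<integral>z. \<Phi> * b * Q r (norm z) \<partial>\<nu>)"
    unfolding g2_def using g2m integral_\<nu>[of "\<lambda>z. \<Phi> * b * Q r (norm z)"] Qm by auto
  have Hint: "integrable \<nu> (indicator (shared_targets a) :: 'a \<Rightarrow> real)"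
    using emeasure_\<nu>_shared_targets(2)[of a] a0 r0 by (intro integrable_real_indicator) (auto simp: r_def)
  have Hm: "(indicator (shared_targets a) :: 'a \<Rightarrow> real) \<in> borel_measurable lebesgue"
    by simp
  have m: "integrable lebesgue m" "integral\<^sup>L lebesgue m = \<Phi> * c * measure \<nu> (shared_targets a)"
    unfolding m_def using integral_\<nu>[OF Hm] Hint by auto
  have f1: "integrable lebesgue f1" "integrable lebesgue f2"
    unfolding f1_def f2_def using int1 int2 by auto
  have "(\<integral>w. f1 (S w) + f2 w \<partial>lebesgue) \<le> (\<integral>w. g1 (S w) + g2 w - m w \<partial>lebesgue)"
  proof (rule integral_mono_AE)
    have "AE w in lebesgue. w \<noteq> 0 \<and> w \<noteq> a"
      by (intro AE_conjI AE_completion AE_lborel_singleton)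
    then show "AE w in lebesgue. f1 (S w) + f2 w \<le> g1 (S w) + g2 w - m w"
    proof eventually_elim
      case (elim w)
      define U where "U = u (y + w)"
      define \<mu> where "\<mu> = c * (indicator (shared_targets a) w * J w)"
      define p1 where "p1 = \<Phi> * b * Q r (norm (S w)) + P (S w)"
      define p2 where "p2 = \<Phi> * b * Q r (norm w)"
      have Sw: "S w = w - a" "x + S w = y + w" by (auto simp: S_def a_def)
      have K1: "1 / C * J (S w) \<le> k1 (S w)" "k1 (S w) \<le> C * J (S w)"
        using k1[of "S w"] elim by (auto simp: Sw)
      have K2: "1 / C * J w \<le> k2 w" "k2 w \<le> C * J w"
        using k2[of w] elim by auto
      have \<mu>0: "0 \<le> \<mu>" using c0 J_nonneg by (simp add: \<mu>_def)
      have \<mu>1: "\<mu> \<le> k1 (S w)"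
      proof (cases "w \<in> shared_targets a")
        case True
        then have "\<mu> \<le> c * (2 ^ (DIM('a) + 1) * J (S w))"
          using J_shared_targets[OF a0 True] c0 by (simp add: \<mu>_def Sw)
        also have "\<dots> = 1 / C * J (S w)" using C by (simp add: c_def)
        finally show ?thesis using K1 by linarith
      next
        case False
        have "0 \<le> 1 / C * J (S w)" using C J_nonneg[of "S w"] by simp
        then show ?thesis using K1 False by (simp add: \<mu>_def)
      qed
      have \<mu>2: "\<mu> \<le> k2 w"
      proof -
        have "\<mu> \<le> c * J w" using c0 J_nonneg[of w] by (auto simp: \<mu>_def indicator_def)
        also have "\<dots> \<le> 1 / C * J w"
        proof (rule mult_right_mono[OF _ J_nonneg])
          have "C * 1 \<le> C * 2 ^ (DIM('a) + 1)" using C by (intro mult_left_mono one_le_power) auto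
          then show "c \<le> 1 / C" using C unfolding c_def by (intro divide_left_mono) auto
        qed
        finally show ?thesis using K2 by linarith
      qed
      have p1: "U - u x \<le> p1"
      proof -
        have "U - u x \<le> \<Phi> * ((N r / N (norm (a + S w))) powr b - 1) + P (S w)"
          using h1[of "S w"] elim by (simp add: Sw U_def r_def a_def add.commute[of w y])
        also have "\<dots> \<le> \<Phi> * (b * Q r (norm (S w))) + P (S w)"
          using displacement_cost[OF b a0, of "S w"] elim \<Phi>
          by (intro add_right_mono mult_left_mono) (auto simp: r_def Sw)
        finally show ?thesis by (simp add: p1_def mult.assoc)
      qed
      have p2: "u y - U \<le> p2"
      proof -
        have *: "x - (y + w) = a + (- w)" by (simp add: a_def)
        have "a \<noteq> w" "x \<noteq> y + w" using elim by (auto simp: a_def)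
        then have "u y - U \<le> \<Phi> * ((N r / N (norm (a + (- w)))) powr b - 1)"
          using h2[of w] unfolding * U_def r_def by (simp add: a_def)
        also have "\<dots> \<le> \<Phi> * (b * Q r (norm (- w)))"
          unfolding r_def using \<open>a \<noteq> w\<close> \<Phi> by (intro mult_left_mono displacement_cost[OF b a0]) auto
        finally show ?thesis by (simp add: p2_def mult.assoc)
      qed
      have p0: "0 \<le> p1" "0 \<le> p2"
        using b \<Phi> P(2) Q_nonneg[OF r0(1)] by (auto simp: p1_def p2_def)
      have "f1 (S w) + f2 w = (U - u x) * (k1 (S w) - \<mu>) + (u y - U) * (k2 w - \<mu>) - \<mu> * (u x - u y)"
        unfolding f1_def f2_def Sw(2) U_def by (simp add: algebra_simps)
      also have "\<dots> \<le> p1 * (k1 (S w) - \<mu>) + p2 * (k2 w - \<mu>) - \<mu> * \<Phi>"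
        using p1 p2 \<mu>0 \<mu>1 \<mu>2 \<Phi> by (intro diff_mono add_mono mult_right_mono mult_left_mono) auto
      also have "\<dots> \<le> p1 * (C * J (S w)) + p2 * (C * J w) - \<mu> * \<Phi>"
        using p0 \<mu>0 K1 K2 by (intro diff_right_mono add_mono mult_left_mono) auto
      also have "\<dots> = g1 (S w) + g2 w - m w"
        by (simp add: g1_def g2_def m_def p1_def p2_def \<mu>_def mult_ac)
      finally show ?case .
    qed
  qed (use f1 g1 g2 m shift in auto)
  then have "integral\<^sup>L lebesgue f1 + integral\<^sup>L lebesgue f2 \<le>
      integral\<^sup>L lebesgue g1 + integral\<^sup>L lebesgue g2 - integral\<^sup>L lebesgue m"
    using shift[OF f1(1)] shift[OF g1(1)] f1 g2 m by simp
  also have "\<dots> = C * integral\<^sup>L \<nu> P + 2 * C * \<Phi> * b * (\<integral>z. Q r (norm z) \<partial>\<nu>) - \<Phi> * c * measure \<nu> (shared_targets a)"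
    unfolding g1 g2 m using Q_integral(1)[OF r0] P(1) by (simp add: algebra_simps)
  also have "\<dots> \<le> C * integral\<^sup>L \<nu> P + 2 * C * \<Phi> * b * (17 * \<sigma> * M r) - \<Phi> * c * (\<sigma> * M r / 4)"
  proof (intro diff_mono add_left_mono mult_left_mono)
    show "(\<integral>z. Q r (norm z) \<partial>\<nu>) \<le> 17 * \<sigma> * M r" by (rule Q_integral(2)[OF r0])
    have "ennreal (\<sigma> * M r / 4) \<le> ennreal (measure \<nu> (shared_targets a))"
      using emeasure_\<nu>_shared_targets[of a] a0 r0 by (simp add: r_def emeasure_eq_ennreal_measure)
    then show "\<sigma> * M r / 4 \<le> measure \<nu> (shared_targets a)"
      by (simp add: ennreal_le_iff)
  qed (use C \<Phi> b c0 in auto)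
  also have "\<dots> = C * integral\<^sup>L \<nu> P + \<sigma> * M r * \<Phi> * (34 * C * b - 1 / (C * 2 ^ (DIM('a) + 3)))"
    using C by (simp add: c_def field_simps power_add)
  finally have "integral\<^sup>L lebesgue f1 + integral\<^sup>L lebesgue f2 \<le>
    C * integral\<^sup>L \<nu> P + \<sigma> * M r * \<Phi> * (34 * C * b - 1 / (C * 2 ^ (DIM('a) + 3)))" .
  moreover have "integral\<^sup>L lebesgue f1 = - (\<integral>z. (u x - u (x + z)) * k1 z \<partial>lebesgue)"
    unfolding f1_def by (rule integral_minus)
  ultimately show ?thesis
    by (simp add: f2_def[abs_def] r_def a_def)
qed

end

section \<open>Penalization at spatial infinity\<close>

text \<open>
  Up to first order in \<open>\<epsilon>\<close> this is \<open>\<epsilon> * ln (1 + x \<bullet> x)\<close>, but it stays below \<open>1\<close>.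
\<close>

definition penalty :: "real \<Rightarrow> 'a::euclidean_space \<Rightarrow> real" where
  "penalty \<epsilon> x = 1 - (1 + x \<bullet> x) powr (- \<epsilon>)"

lemma one_plus_inner_ge_1: "1 \<le> 1 + x \<bullet> (x :: 'a::real_inner)"
  by simp

lemma penalty_nonneg: "0 \<le> \<epsilon> \<Longrightarrow> 0 \<le> penalty \<epsilon> x"
  using powr_mono[of "- \<epsilon>" 0 "1 + x \<bullet> x"] one_plus_inner_ge_1[of x]
  by (simp add: penalty_def)

lemma penalty_le_1: "penalty \<epsilon> x \<le> 1"
  by (simp add: penalty_def)

lemma continuous_penalty: "continuous_on S (penalty \<epsilon>)"
proof -
  have "1 + x \<bullet> x \<noteq> 0" for x :: 'a
    using one_plus_inner_ge_1[of x] by linarith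
  then show ?thesis
    unfolding penalty_def by (intro continuous_intros) auto
qed

lemma penalty_sublevel:
  assumes "0 < \<epsilon>" "penalty \<epsilon> x \<le> 2 / 3"
  shows "norm x \<le> 3 powr (1 / \<epsilon>)"
proof -
  have p: "1 \<le> 1 + x \<bullet> x" by (rule one_plus_inner_ge_1)
  have "1 / 3 \<le> (1 + x \<bullet> x) powr (- \<epsilon>)" using assms by (simp add: penalty_def)
  then have "(1 + x \<bullet> x) powr \<epsilon> \<le> 3"
    using p by (simp add: powr_minus field_simps)
  then have "((1 + x \<bullet> x) powr \<epsilon>) powr (1 / \<epsilon>) \<le> 3 powr (1 / \<epsilon>)"
    using assms by (intro powr_mono2) auto
  then have 1: "1 + x \<bullet> x \<le> 3 powr (1 / \<epsilon>)"
    using assms p by (simp add: powr_powr)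
  have "2 * norm x \<le> 1 + (norm x)\<^sup>2"
    using sum_squares_bound[of "norm x" 1] by simp
  then have "norm x \<le> 1 + (norm x)\<^sup>2"
    using norm_ge_zero[of x] by linarith
  with 1 show ?thesis by (simp add: power2_norm_eq_inner)
qed

lemma penalty_gderiv:
  fixes x :: "'a::euclidean_space"
  shows "GDERIV (penalty \<epsilon>) x :> (2 * \<epsilon> * (1 + x \<bullet> x) powr (- \<epsilon> - 1)) *\<^sub>R x"
proof -
  have 1: "GDERIV (\<lambda>x. 1 + x \<bullet> x) x :> 2 *\<^sub>R x"
    unfolding gderiv_def
    by (rule has_derivative_eq_rhs, (rule derivative_intros)+) (auto simp: inner_commute)
  have p: "0 < 1 + x \<bullet> x" using one_plus_inner_ge_1[of x] by linarith
  have 2: "((\<lambda>s. 1 - s powr (- \<epsilon>)) has_real_derivative \<epsilon> * (1 + x \<bullet> x) powr (- \<epsilon> - 1)) (at (1 + x \<bullet> x))"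
    using p by (auto intro!: derivative_eq_intros)
  from GDERIV_DERIV_compose[OF 1 2] show ?thesis
    by (simp add: penalty_def[abs_def] mult_ac)
qed

lemma norm_penalty_gradient:
  fixes x :: "'a::euclidean_space"
  assumes "0 < \<epsilon>"
  shows "norm ((2 * \<epsilon> * (1 + x \<bullet> x) powr (- \<epsilon> - 1)) *\<^sub>R x) \<le> 2 * \<epsilon> * norm x / (1 + (norm x)\<^sup>2)"
proof -
  have p: "1 \<le> 1 + x \<bullet> x" by (rule one_plus_inner_ge_1)
  have "(1 + x \<bullet> x) powr (- \<epsilon> - 1) \<le> (1 + x \<bullet> x) powr (- 1)"
    using p assms by (intro powr_mono) auto
  also have "\<dots> = 1 / (1 + (norm x)\<^sup>2)"
    using p by (simp add: powr_minus divide_inverse power2_norm_eq_inner)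
  finally have "2 * \<epsilon> * norm x * (1 + x \<bullet> x) powr (- \<epsilon> - 1) \<le> 2 * \<epsilon> * norm x * (1 / (1 + (norm x)\<^sup>2))"
    using assms by (intro mult_left_mono) auto
  then show ?thesis using assms by (simp add: mult_ac)
qed

lemma penalty_increment_le:
  fixes x z :: "'a::euclidean_space"
  assumes "0 < \<epsilon>"
  shows "penalty \<epsilon> (x + z) - penalty \<epsilon> x \<le> min 1 (\<epsilon> * norm z)"
proof -
  have "norm (penalty \<epsilon> (x + z) - penalty \<epsilon> x) \<le> \<epsilon> * norm (x + z - x)"
  proof (rule differentiable_bound[of UNIV _ "\<lambda>x h. h \<bullet> ((2 * \<epsilon> * (1 + x \<bullet> x) powr (- \<epsilon> - 1)) *\<^sub>R x)"])
    fix x :: 'a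
    show "(penalty \<epsilon> has_derivative (\<lambda>h. h \<bullet> ((2 * \<epsilon> * (1 + x \<bullet> x) powr (- \<epsilon> - 1)) *\<^sub>R x))) (at x)"
      using penalty_gderiv[of \<epsilon> x] by (simp add: gderiv_def)
    have "norm ((2 * \<epsilon> * (1 + x \<bullet> x) powr (- \<epsilon> - 1)) *\<^sub>R x) \<le> \<epsilon> * (2 * norm x / (1 + (norm x)\<^sup>2))"
      using norm_penalty_gradient[OF assms, of x] by (simp add: mult_ac)
    also have "\<dots> \<le> \<epsilon> * 1"
    proof (intro mult_left_mono)
      have "0 < 1 + (norm x)\<^sup>2" by (simp add: add_pos_nonneg)
      then show "2 * norm x / (1 + (norm x)\<^sup>2) \<le> 1"
        using sum_squares_bound[of "norm x" 1] by (simp add: pos_divide_le_eq power2_eq_square add.commute)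
    qed (use assms in auto)
    finally have g: "norm ((2 * \<epsilon> * (1 + x \<bullet> x) powr (- \<epsilon> - 1)) *\<^sub>R x) \<le> \<epsilon>" by simp
    show "onorm (\<lambda>h. h \<bullet> ((2 * \<epsilon> * (1 + x \<bullet> x) powr (- \<epsilon> - 1)) *\<^sub>R x)) \<le> \<epsilon>"
    proof (rule onorm_le)
      fix h :: 'a
      have "norm (h \<bullet> ((2 * \<epsilon> * (1 + x \<bullet> x) powr (- \<epsilon> - 1)) *\<^sub>R x)) \<le> norm h * norm ((2 * \<epsilon> * (1 + x \<bullet> x) powr (- \<epsilon> - 1)) *\<^sub>R x)"
        by (simp only: real_norm_def) (rule Cauchy_Schwarz_ineq2)
      also have "\<dots> \<le> norm h * \<epsilon>" by (intro mult_left_mono g) simp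
      finally show "norm (h \<bullet> ((2 * \<epsilon> * (1 + x \<bullet> x) powr (- \<epsilon> - 1)) *\<^sub>R x)) \<le> \<epsilon> * norm h"
        by (simp add: mult.commute)
    qed
  qed auto
  moreover have "penalty \<epsilon> (x + z) - penalty \<epsilon> x \<le> 1"
    using penalty_le_1[of \<epsilon> "x + z"] penalty_nonneg[of \<epsilon> x] assms by linarith
  ultimately show ?thesis by auto
qed

lemma penalty_tendsto_0:
  fixes \<epsilon> :: "nat \<Rightarrow> real"
  assumes "\<epsilon> \<longlonglongrightarrow> 0"
  shows "(\<lambda>n. penalty (\<epsilon> n) x) \<longlonglongrightarrow> 0"
proof -
  have "1 + x \<bullet> x \<noteq> 0" using one_plus_inner_ge_1[of x] by linarith
  then have "(\<lambda>n. 1 - (1 + x \<bullet> x) powr (- \<epsilon> n)) \<longlonglongrightarrow> 1 - (1 + x \<bullet> x) powr (- 0)"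
    by (intro tendsto_intros assms) auto
  with \<open>1 + x \<bullet> x \<noteq> 0\<close> show ?thesis by (simp add: penalty_def)
qed

context critical_profile
begin

lemma penalty_cost_integrable:
  assumes "0 \<le> \<epsilon>"
  shows "integrable \<nu> (\<lambda>z. min 1 (\<epsilon> * norm z))"
proof (rule integrableI_nonneg)
  have m1: "(\<lambda>z::'a. ennreal \<epsilon> * (ennreal (norm z) * indicator {z. norm z < R} z)) \<in> borel_measurable \<nu>"
    by (intro borel_measurable_\<nu>) measurable
  have m2: "(\<lambda>z::'a. indicator {z. R \<le> norm z} z :: ennreal) \<in> borel_measurable \<nu>"
    by (intro borel_measurable_\<nu>) measurable
  have m3: "(\<lambda>z::'a. ennreal (norm z) * indicator {z. norm z < R} z) \<in> borel_measurable \<nu>"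
    by (intro borel_measurable_\<nu>) measurable
  have Rp: "0 < R" using \<rho>_pos \<rho>_le by simp
  have "(\<integral>\<^sup>+z. ennreal (min 1 (\<epsilon> * norm z)) \<partial>\<nu>) \<le>
    (\<integral>\<^sup>+z. ennreal \<epsilon> * (ennreal (norm z) * indicator {z. norm z < R} z) + indicator {z. R \<le> norm z} z \<partial>\<nu>)"
  proof (rule nn_integral_mono)
    fix z :: 'a
    have "ennreal (min 1 (\<epsilon> * norm z)) \<le> ennreal (\<epsilon> * norm z)"
      by (rule ennreal_leI) simp
    moreover have "ennreal (min 1 (\<epsilon> * norm z)) \<le> ennreal 1"
      by (rule ennreal_leI) simp
    ultimately show "ennreal (min 1 (\<epsilon> * norm z)) \<le>
        ennreal \<epsilon> * (ennreal (norm z) * indicator {z. norm z < R} z) + indicator {z. R \<le> norm z} z"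
      using assms by (cases "norm z < R") (auto simp: ennreal_mult)
  qed
  also have "\<dots> = ennreal \<epsilon> * (\<integral>\<^sup>+z. ennreal (norm z) * indicator {z. norm z < R} z \<partial>\<nu>) + emeasure \<nu> {z. R \<le> norm z}"
    using m1 m2 m3 by (simp add: nn_integral_add nn_integral_cmult)
  also have "\<dots> \<le> ennreal \<epsilon> * ennreal (5 * \<sigma> * R * M R) + ennreal (\<sigma> * M R)"
    using first_moment[of R] emeasure_tail[of R] Rp by (intro add_mono mult_left_mono) auto
  also have "\<dots> < \<infinity>"
    by (simp add: ennreal_mult_less_top)
  finally show "(\<integral>\<^sup>+z. ennreal (min 1 (\<epsilon> * norm z)) \<partial>\<nu>) < \<infinity>" .
  show "(\<lambda>z. min 1 (\<epsilon> * norm z)) \<in> borel_measurable \<nu>"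
    by (intro borel_measurable_\<nu>) measurable
qed (use assms in auto)

lemma penalty_cost_tendsto_0:
  "(\<lambda>n. \<integral>z. min 1 (1 / real (Suc n) * norm z) \<partial>\<nu>) \<longlonglongrightarrow> 0"
proof -
  have "(\<lambda>n. \<integral>z. min 1 (1 / real (Suc n) * norm z) \<partial>\<nu>) \<longlonglongrightarrow> (\<integral>z. (\<lambda>_::'a. 0) z \<partial>\<nu>)"
  proof (rule integral_dominated_convergence)
    show "integrable \<nu> (\<lambda>z. min 1 (1 * norm z))"
      by (rule penalty_cost_integrable) simp
    show "AE z in \<nu>. (\<lambda>n. min 1 (1 / real (Suc n) * norm z)) \<longlonglongrightarrow> 0"
    proof (rule AE_I2)
      fix z :: 'a
      have "(\<lambda>n. min 1 (inverse (real (Suc n)) * norm z)) \<longlonglongrightarrow> min 1 (0 * norm z)"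
        by (intro tendsto_intros LIMSEQ_inverse_real_of_nat)
      then show "(\<lambda>n. min 1 (1 / real (Suc n) * norm z)) \<longlonglongrightarrow> 0"
        by (simp add: inverse_eq_divide)
    qed
    show "AE z in \<nu>. norm (min 1 (1 / real (Suc n) * norm z)) \<le> min 1 (1 * norm z)" for n
    proof (rule AE_I2)
      fix z :: 'a
      have "1 / real (Suc n) * norm z \<le> 1 * norm z"
        by (intro mult_right_mono) auto
      moreover have "0 \<le> 1 / real (Suc n) * norm z" by simp
      ultimately show "norm (min 1 (1 / real (Suc n) * norm z)) \<le> min 1 (1 * norm z)"
        by (auto simp: min_def simp del: of_nat_Suc)
    qed
    show "(\<lambda>z. min 1 (1 / real (Suc n) * norm z)) \<in> borel_measurable \<nu>" for n
      by (intro borel_measurable_\<nu>) measurable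
  qed (simp add: borel_measurable_\<nu>)
  then show ?thesis by simp
qed

end

section \<open>The maximum principle for the doubled equation\<close>

text \<open>
  Test the one-sided bound along the direction of steepest descent.
\<close>

lemma gradient_norm_le:
  fixes f :: "'a::euclidean_space \<Rightarrow> real"
  assumes g: "GDERIV f y :> g" and r: "0 < r" and D: "0 \<le> D"
    and le: "\<And>h. norm h < r \<Longrightarrow> f y - f (y + h) \<le> D * norm h"
  shows "norm g \<le> D"
proof (rule ccontr)
  assume "\<not> norm g \<le> D"
  then have gD: "D < norm g" by simp
  then have g0: "0 < norm g" using D by linarith
  define \<phi> where "\<phi> s = f (y + s *\<^sub>R (- g)) + D * norm g * s" for s
  have "((\<lambda>s. f (y + s *\<^sub>R (- g))) has_derivative (\<lambda>s. (s *\<^sub>R (- g)) \<bullet> g)) (at 0)"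
  proof (rule has_derivative_compose[where f = "\<lambda>s. y + s *\<^sub>R (- g)" and g = f and f' = "\<lambda>s. s *\<^sub>R (- g)" and g' = "\<lambda>h. h \<bullet> g"])
    show "((\<lambda>s. y + s *\<^sub>R (- g)) has_derivative (\<lambda>s. s *\<^sub>R (- g))) (at 0)"
      by (auto intro!: derivative_eq_intros)
    show "(f has_derivative (\<lambda>h. h \<bullet> g)) (at (y + 0 *\<^sub>R (- g)))"
      using g by (simp add: gderiv_def)
  qed
  then have "((\<lambda>s. f (y + s *\<^sub>R (- g))) has_real_derivative - (g \<bullet> g)) (at 0)"
    unfolding has_field_derivative_def by (rule has_derivative_eq_rhs) (auto simp: mult.commute)
  then have "(\<phi> has_real_derivative - (g \<bullet> g) + D * norm g) (at 0)"
    unfolding \<phi>_def[abs_def] by (auto intro!: derivative_eq_intros)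
  moreover have "- (g \<bullet> g) + D * norm g < 0"
    using gD g0 by (simp add: power2_norm_eq_inner[symmetric] power2_eq_square)
  ultimately obtain d where d: "0 < d" "\<And>s. 0 < s \<Longrightarrow> s < d \<Longrightarrow> \<phi> (0 + s) < \<phi> 0"
    using DERIV_neg_dec_right[of \<phi> "- (g \<bullet> g) + D * norm g" 0] by auto
  define s where "s = min (d / 2) (r / (2 * norm g))"
  have s: "0 < s" "s < d" using d r g0 by (auto simp: s_def)
  have "s * norm g \<le> r / (2 * norm g) * norm g"
    by (intro mult_right_mono) (auto simp: s_def)
  also have "\<dots> < r" using g0 r by simp
  finally have "f y - f (y + s *\<^sub>R (- g)) \<le> D * norm (s *\<^sub>R (- g))"
    using s by (intro le) simp
  then have "\<phi> 0 \<le> \<phi> (0 + s)"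
    using s by (simp add: \<phi>_def mult_ac)
  with d(2)[OF s] show False by simp
qed

text \<open>
  Moving both points by the same vector does not change their distance, so the barrier, which need not
  be differentiable in space, does not enter.
\<close>

lemma gradients_eq_at_max:
  fixes f :: "'a::euclidean_space \<Rightarrow> real"
  assumes "GDERIV f x :> g" "GDERIV f y :> h" "GDERIV p x :> w"
    and max: "\<And>z. f (x + z) - f (y + z) - p (x + z) \<le> f x - f y - p x"
  shows "g = h + w"
proof -
  have shift: "((\<lambda>z. e (c + z)) has_derivative (\<lambda>z. z \<bullet> j)) (at 0)" if "GDERIV e c :> j" for e :: "'a \<Rightarrow> real" and c j
  proof (rule has_derivative_compose[where f = "\<lambda>z. c + z" and g = e and f' = "\<lambda>z. z" and g' = "\<lambda>h. h \<bullet> j"])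
    show "((\<lambda>z. c + z) has_derivative (\<lambda>z. z)) (at 0)"
      by (auto intro!: derivative_eq_intros)
    show "(e has_derivative (\<lambda>h. h \<bullet> j)) (at (c + 0))"
      using that by (simp add: gderiv_def)
  qed
  have "((\<lambda>z. f (x + z) - f (y + z) - p (x + z)) has_derivative (\<lambda>z. z \<bullet> g - z \<bullet> h - z \<bullet> w)) (at 0)"
    by (intro has_derivative_diff shift assms)
  from differential_zero_maxmin[OF _ _ this, of UNIV]
  have "(\<lambda>z. z \<bullet> g - z \<bullet> h - z \<bullet> w) = (\<lambda>z. 0)"
    using max by auto
  then have "(g - h - w) \<bullet> g - (g - h - w) \<bullet> h - (g - h - w) \<bullet> w = 0"
    by (rule fun_cong)
  then have "(g - h - w) \<bullet> (g - h - w) = 0"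
    by (simp add: inner_diff_right)
  then have "g - h - w = 0" by (simp only: inner_eq_zero_iff)
  then show ?thesis by (simp add: algebra_simps)
qed

context critical_profile
begin

text \<open>
  The coalescence rate of two particles at distance \<open>r\<close> is at least \<open>gain C * M r\<close>.
\<close>

definition gain :: "real \<Rightarrow> real" where
  "gain C = \<sigma> / (C * 2 ^ (DIM('a) + 3))"

text \<open>
  The equations at \<open>x\<close> and \<open>y\<close> are subtracted. Varying one point gives the hypotheses of
  \<open>nonlocal_difference_le\<close> and the size of the gradient at \<open>y\<close>; varying both points
  shows that the gradients differ only by that of the penalty, so that the drift enters through
  \<open>v t x - v t y\<close>.
\<close>

lemma inequality_at_spatial_max:
  fixes k :: "'a \<Rightarrow> 'a \<Rightarrow> real \<Rightarrow> real" and v :: "real \<Rightarrow> 'a \<Rightarrow> 'a" and q :: "real \<Rightarrow> 'a \<Rightarrow> real"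
  assumes A1: "assm_A1 C \<eta> k" and A6: "assm_A6 C1 C2 \<eta> v" and C: "0 < C" "0 < C1" "0 < C2"
    and t: "0 < t" and xy: "x \<noteq> y" "norm (x - y) \<le> \<rho>"
    and x: "integrable lebesgue (\<lambda>z. (q t x - q t (x + z)) * k x z t)"
      "gderiv (q t) x gx" "qx + v t x \<bullet> gx + nonlocal_op k q t x = 0"
    and y: "integrable lebesgue (\<lambda>z. (q t y - q t (y + z)) * k y z t)"
      "gderiv (q t) y gy" "qy + v t y \<bullet> gy + nonlocal_op k q t y = 0"
    and b: "0 \<le> b" "b \<le> 1 / 2" and \<Phi>: "0 \<le> \<Phi>" "\<Phi> \<le> q t x - q t y"
    and A: "0 \<le> A" and \<epsilon>: "0 < \<epsilon>"
    and max: "\<And>x' y'. x' \<noteq> y' \<Longrightarrow>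
      q t x' - q t y' - \<Phi> * (N (norm (x - y)) / N (norm (x' - y'))) powr b - A * penalty \<epsilon> x'
      \<le> q t x - q t y - \<Phi> - A * penalty \<epsilon> x"
  shows "qx - qy \<le> M (norm (x - y)) * \<Phi> * (34 * \<sigma> * C * b + C2 * b - gain C)
    + A * (3 * \<epsilon> * C1 + C * (\<integral>z. min 1 (\<epsilon> * norm z) \<partial>\<nu>))"
proof -
  define r where "r = norm (x - y)"
  have r: "0 < r" "r \<le> \<rho>" "r \<le> 1" using xy \<rho>_le R_le_1 \<rho>_pos by (auto simp: r_def)
  have Mr: "0 \<le> M r" by (rule M_nonneg[OF r(1)])
  define w where "w = (2 * \<epsilon> * (1 + x \<bullet> x) powr (- \<epsilon> - 1)) *\<^sub>R x"
  define P where "P z = A * min 1 (\<epsilon> * norm z)" for z :: 'a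
  have k: "1 / C * J z \<le> k p z t \<and> k p z t \<le> C * J z" if "z \<noteq> 0" for p z
    using A1 t that by (auto simp: assm_A1_def J_def)
  have nonlocal: "nonlocal_op k q t y - nonlocal_op k q t x
    \<le> C * integral\<^sup>L \<nu> P + \<sigma> * M r * \<Phi> * (34 * C * b - 1 / (C * 2 ^ (DIM('a) + 3)))"
    unfolding nonlocal_op_def r_def
  proof (rule nonlocal_difference_le[OF xy C(1) k k x(1) y(1) b \<Phi>])
    show "integrable \<nu> P"
      unfolding P_def using penalty_cost_integrable[of \<epsilon>] \<epsilon> by auto
    show "0 \<le> P z" for z using A \<epsilon> by (simp add: P_def)
    show "q t (x + z) - q t x \<le> \<Phi> * ((N (norm (x - y)) / N (norm (x + z - y))) powr b - 1) + P z"
      if "x + z \<noteq> y" for z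
    proof -
      have "A * penalty \<epsilon> (x + z) - A * penalty \<epsilon> x \<le> P z"
        using mult_left_mono[OF penalty_increment_le[OF \<epsilon>, of x z] A]
        by (simp add: P_def right_diff_distrib)
      then show ?thesis using max[OF that] by (simp add: algebra_simps)
    qed
    show "q t y - q t (y + z) \<le> \<Phi> * ((N (norm (x - y)) / N (norm (x - (y + z)))) powr b - 1)"
      if "x \<noteq> y + z" for z
      using max[OF that] by (simp add: algebra_simps)
  qed
  have "GDERIV (\<lambda>x. A * penalty \<epsilon> x) x :> A *\<^sub>R w"
    using penalty_gderiv[of \<epsilon> x] unfolding gderiv_def w_def
    by (auto intro!: derivative_eq_intros)
  then have gx: "gx = gy + A *\<^sub>R w"
  proof (rule gradients_eq_at_max[OF x(2) y(2)])
    fix z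
    have "N r / N r = 1" using N_pos[OF r(1)] by simp
    then show "q t (x + z) - q t (y + z) - A * penalty \<epsilon> (x + z) \<le> q t x - q t y - A * penalty \<epsilon> x"
      using max[of "x + z" "y + z"] xy by (simp add: r_def)
  qed
  have gy: "norm gy \<le> b * \<Phi> / r"
  proof (rule gradient_norm_le[OF y(2) r(1)])
    fix h :: 'a assume h: "norm h < r"
    then have "x \<noteq> y + h" by (auto simp: r_def)
    then have "q t y - q t (y + h) \<le> \<Phi> * ((N r / N (norm (x - y + (- h)))) powr b - 1)"
      using max[of x "y + h"] by (simp add: algebra_simps r_def)
    also have "\<dots> \<le> \<Phi> * (b * Q r (norm (- h)))"
      unfolding r_def using \<open>x \<noteq> y + h\<close> xy \<Phi>
      by (intro mult_left_mono displacement_cost b) (auto simp: algebra_simps)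
    also have "\<dots> = b * \<Phi> / r * norm h"
      using h by (simp add: Q_def)
    finally show "q t y - q t (y + h) \<le> b * \<Phi> / r * norm h" .
  qed (use b \<Phi> r in auto)
  have v: "norm (v t x - v t y) \<le> C2 * r * M r"
    using A6 t r unfolding assm_A6_def r_def M_eq by auto
  have drift1: "- ((v t x - v t y) \<bullet> gy) \<le> C2 * b * (M r * \<Phi>)"
  proof -
    have "- ((v t x - v t y) \<bullet> gy) \<le> norm (v t x - v t y) * norm gy"
      using Cauchy_Schwarz_ineq2[of "v t x - v t y" gy] by linarith
    also have "\<dots> \<le> (C2 * r * M r) * (b * \<Phi> / r)"
      using C r Mr by (intro mult_mono v gy) auto
    also have "\<dots> = C2 * b * (M r * \<Phi>)" using r by simp
    finally show ?thesis .
  qed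
  have drift2: "- (v t x \<bullet> w) \<le> 3 * \<epsilon> * C1"
  proof -
    have p: "0 < 1 + (norm x)\<^sup>2" by (simp add: add_pos_nonneg)
    have "- (v t x \<bullet> w) \<le> norm (v t x) * norm w"
      using Cauchy_Schwarz_ineq2[of "v t x" w] by linarith
    also have "\<dots> \<le> (C1 * (1 + norm x)) * (2 * \<epsilon> * norm x / (1 + (norm x)\<^sup>2))"
      using A6 t C norm_penalty_gradient[OF \<epsilon>, of x] unfolding assm_A6_def w_def
      by (intro mult_mono) auto
    also have "\<dots> = C1 * \<epsilon> * ((2 * norm x + 2 * (norm x)\<^sup>2) / (1 + (norm x)\<^sup>2))"
      by (simp add: power2_eq_square algebra_simps)
    also have "\<dots> \<le> C1 * \<epsilon> * 3"
    proof (intro mult_left_mono)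
      have "2 * norm x \<le> 1 + (norm x)\<^sup>2" using sum_squares_bound[of "norm x" 1] by simp
      then have "2 * norm x + 2 * (norm x)\<^sup>2 \<le> 3 * (1 + (norm x)\<^sup>2)" by simp
      then show "(2 * norm x + 2 * (norm x)\<^sup>2) / (1 + (norm x)\<^sup>2) \<le> 3"
        using p by (simp add: pos_divide_le_eq)
    qed (use C \<epsilon> in auto)
    finally show ?thesis by (simp add: mult_ac)
  qed
  have "qx - qy = - ((v t x - v t y) \<bullet> gy) + A * (- (v t x \<bullet> w)) + (nonlocal_op k q t y - nonlocal_op k q t x)"
    using x(3) y(3) by (simp add: gx inner_add_right inner_diff_left)
  also have "\<dots> \<le> C2 * b * (M r * \<Phi>) + A * (3 * \<epsilon> * C1) +
      (C * integral\<^sup>L \<nu> P + \<sigma> * M r * \<Phi> * (34 * C * b - 1 / (C * 2 ^ (DIM('a) + 3))))"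
    using A by (intro add_mono drift1 nonlocal mult_left_mono drift2) auto
  also have "integral\<^sup>L \<nu> P = A * (\<integral>z. min 1 (\<epsilon> * norm z) \<partial>\<nu>)"
    unfolding P_def by simp
  finally show ?thesis
    by (simp add: gain_def r_def algebra_simps)
qed

text \<open>
  If the penalized inequality failed somewhere, the difference of both sides would attain a positive
  global maximum. There the time derivative of the difference is nonnegative; the maximum
  may sit at time \<open>1\<close>, but a comparison with earlier times suffices for this. With \<open>inequality_at_spatial_max\<close> this
  contradicts the smallness of \<open>b\<close> and \<open>\<epsilon>\<close>; the penalty error is absorbed because
  \<open>M r * \<Phi> \<ge> 2 * B * M \<rho>\<close> uniformly in the position of the maximum. The factor \<open>3 * B\<close> of the penalty exceeds
  the oscillation \<open>2 * B\<close>, so that it wins at infinity.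
\<close>

lemma penalized_comparison:
  fixes k :: "'a \<Rightarrow> 'a \<Rightarrow> real \<Rightarrow> real" and v :: "real \<Rightarrow> 'a \<Rightarrow> 'a" and q :: "real \<Rightarrow> 'a \<Rightarrow> real"
  assumes A1: "assm_A1 C \<eta> k" and A6: "assm_A6 C1 C2 \<eta> v" and C: "0 < C" "0 < C1" "0 < C2"
    and sol: "bounded_solution k v q"
    and B: "0 < B" "\<And>t x. 0 \<le> t \<Longrightarrow> t \<le> 1 \<Longrightarrow> \<bar>q t x\<bar> \<le> B"
    and b: "0 \<le> b" "b \<le> 1 / 2"
    and small_b: "34 * \<sigma> * C * b + C2 * b + b / M \<rho> \<le> gain C / 2"
    and \<epsilon>: "0 < \<epsilon>"
    and small_\<epsilon>: "3 * B * (3 * \<epsilon> * C1 + C * (\<integral>z. min 1 (\<epsilon> * norm z) \<partial>\<nu>)) < gain C / 2 * (2 * B * M \<rho>)"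
    and \<tau>: "0 < \<tau>" and t: "\<tau> < t" "t \<le> 1" and xy: "x \<noteq> y"
  shows "q t x - q t y \<le>
    2 * B * min 1 (((t - \<tau>) * N (norm (x - y)) / M \<rho>) powr (- b)) + 3 * B * penalty \<epsilon> x"
proof (rule ccontr)
  define \<Psi> where "\<Psi> t r = min 1 (((t - \<tau>) * N r / M \<rho>) powr (- b))" for t r
  define w where "w = (\<lambda>(t, x, y). q t x - q t y - 2 * B * \<Psi> t (norm (x - y)) - 3 * B * penalty \<epsilon> x)"
  define \<delta> where "\<delta> = w (t, x, y)"
  assume "\<not> ?thesis"
  then have \<delta>: "0 < \<delta>" by (simp add: \<delta>_def w_def \<Psi>_def)
  have q_cont: "continuous_on ({0<..} \<times> UNIV) (\<lambda>(t, x). q t x)"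
    using sol by (simp add: bounded_solution_def)
  \<comment> \<open>Points where the difference is at least \<open>\<delta>\<close> stay in a compact set: the penalty bounds \<open>x\<close>, the barrier
    being below \<open>2 * B\<close> forces \<open>x\<close> and \<open>y\<close> to be close, uniform continuity of \<open>q\<close> keeps them apart, and
    then the barrier keeps the time away from \<open>\<tau>\<close>.\<close>
  define L where "L = 3 powr (1 / \<epsilon>)"
  have "uniformly_continuous_on ({\<tau>..1} \<times> cball 0 (L + 1)) (\<lambda>(t, x::'a). q t x)"
    by (intro compact_uniformly_continuous continuous_on_subset[OF q_cont] compact_Times)
      (use \<tau> in auto)
  then obtain \<kappa> where \<kappa>: "0 < \<kappa>" and uc:
    "\<And>p p'. p \<in> {\<tau>..1} \<times> cball 0 (L + 1) \<Longrightarrow> p' \<in> {\<tau>..1} \<times> cball (0::'a) (L + 1) \<Longrightarrow> dist p' p < \<kappa> \<Longrightarrow>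
      dist (case p' of (t, x) \<Rightarrow> q t x) (case p of (t, x) \<Rightarrow> q t x) < \<delta>"
    using \<delta> unfolding uniformly_continuous_on_def by metis
  define K where "K = ({\<tau> + M \<rho> / N \<kappa>..1} \<times> cball 0 L \<times> cball 0 (L + 1)) \<inter> {p. \<kappa> \<le> norm (fst (snd p) - snd (snd p) :: 'a)}"
  have N\<kappa>: "0 < N \<kappa>" by (rule N_pos[OF \<kappa>])
  have localize: "(s, x', y') \<in> K \<and> (s - \<tau>) * N (norm (x' - y')) > M \<rho> \<and> norm (x' - y') < \<rho> \<and> q s y' < q s x'"
    if s: "\<tau> < s" "s \<le> 1" and n: "x' \<noteq> y'" and wp: "\<delta> \<le> w (s, x', y')" for s x' y'
  proof -
    have r: "0 < norm (x' - y')" using n by simp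
    have Nr: "0 < N (norm (x' - y'))" by (rule N_pos[OF r])
    have q2: "q s x' - q s y' \<le> 2 * B" "- (2 * B) \<le> q s x' - q s y'"
      using B(2)[of s x'] B(2)[of s y'] s \<tau> by (auto simp: abs_le_iff)
    have \<Psi>0: "0 \<le> 2 * B * \<Psi> s (norm (x' - y'))" using B by (simp add: \<Psi>_def)
    have pen0: "0 \<le> 3 * B * penalty \<epsilon> x'" using B penalty_nonneg[of \<epsilon> x'] \<epsilon> by simp
    have big: "0 < q s x' - q s y' - 2 * B * \<Psi> s (norm (x' - y')) - 3 * B * penalty \<epsilon> x'"
      and big': "\<delta> \<le> q s x' - q s y'"
      using wp \<delta> \<Psi>0 pen0 by (auto simp: w_def)
    have "3 * B * penalty \<epsilon> x' \<le> 3 * B * (2 / 3)" using big q2 \<Psi>0 by simp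
    then have "penalty \<epsilon> x' \<le> 2 / 3" using B(1) by (simp only: mult_le_cancel_left_pos mult_pos_pos zero_less_numeral)
    then have xL: "norm x' \<le> L" unfolding L_def by (rule penalty_sublevel[OF \<epsilon>])
    have "2 * B * \<Psi> s (norm (x' - y')) < 2 * B * 1" using big q2 pen0 by simp
    then have "\<Psi> s (norm (x' - y')) < 1" using B(1) by simp
    then have lt1: "((s - \<tau>) * N (norm (x' - y')) / M \<rho>) powr (- b) < 1" by (simp add: \<Psi>_def)
    have far: "M \<rho> < (s - \<tau>) * N (norm (x' - y'))"
    proof (rule ccontr)
      assume *: "\<not> M \<rho> < (s - \<tau>) * N (norm (x' - y'))"
      have "0 < (s - \<tau>) * N (norm (x' - y')) / M \<rho>" using s Nr M_\<rho>_pos by simp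
      moreover have "(s - \<tau>) * N (norm (x' - y')) / M \<rho> \<le> 1" using * M_\<rho>_pos by simp
      ultimately have "((s - \<tau>) * N (norm (x' - y')) / M \<rho>) powr b \<le> 1"
        "0 < ((s - \<tau>) * N (norm (x' - y')) / M \<rho>) powr b"
        using b by (auto intro!: powr_le1)
      then show False using lt1 by (simp add: powr_minus inverse_eq_divide)
    qed
    also have "(s - \<tau>) * N (norm (x' - y')) \<le> 1 * N (norm (x' - y'))"
      using s \<tau> Nr by (intro mult_right_mono) auto
    finally have near: "norm (x' - y') < \<rho>"
      by (cases "norm (x' - y') < \<rho>") (auto simp: N_def)
    have yL: "norm y' \<le> L + 1"
      using norm_triangle_ineq2[of y' x'] near xL \<rho>_le R_le_1 \<rho>_pos by (simp add: norm_minus_commute)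
    have "\<kappa> \<le> norm (x' - y')"
    proof (rule ccontr)
      assume "\<not> \<kappa> \<le> norm (x' - y')"
      then have "dist (s, x') (s, y') < \<kappa>" by (simp add: dist_Pair_Pair dist_norm)
      then have "dist (q s x') (q s y') < \<delta>"
        using uc[of "(s, y')" "(s, x')"] s xL yL by simp
      then show False using big' by (simp add: dist_real_def)
    qed
    moreover from this have "N (norm (x' - y')) \<le> N \<kappa>"
      by (rule N_antimono[OF \<kappa>])
    then have "(s - \<tau>) * N (norm (x' - y')) \<le> (s - \<tau>) * N \<kappa>" using s by (intro mult_left_mono) auto
    with far have "M \<rho> / N \<kappa> \<le> s - \<tau>" using N\<kappa> by (simp add: pos_divide_le_eq)
    ultimately show ?thesis
      using s xL yL far near big' \<delta> by (auto simp: K_def)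
  qed
  \<comment> \<open>On \<open>K\<close> all ingredients are continuous; neither \<open>t = \<tau>\<close> nor \<open>x = y\<close> occurs there.\<close>
  have K_compact: "compact K"
    unfolding K_def by (intro compact_Int_closed compact_Times closed_Collect_le continuous_intros) auto
  have K_dom: "\<tau> < s \<and> s \<le> 1 \<and> x' \<noteq> y' \<and> \<kappa> \<le> norm (x' - y')" if "(s, x', y') \<in> K" for s x' y'
  proof -
    have "0 < M \<rho> / N \<kappa>" using M_\<rho>_pos N\<kappa> by simp
    then show ?thesis using that \<kappa> by (auto simp: K_def)
  qed
  have w_cont: "continuous_on K w"
  proof -
    have q1: "continuous_on K (\<lambda>p. q (fst p) (fst (snd p)))"
      by (rule continuous_on_compose2[OF q_cont, of K "\<lambda>p. (fst p, fst (snd p))", simplified])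
        (use K_dom \<tau> in \<open>force intro!: continuous_intros\<close>)+
    have q2: "continuous_on K (\<lambda>p. q (fst p) (snd (snd p)))"
      by (rule continuous_on_compose2[OF q_cont, of K "\<lambda>p. (fst p, snd (snd p))", simplified])
        (use K_dom \<tau> in \<open>force intro!: continuous_intros\<close>)+
    have n: "continuous_on K (\<lambda>p. N (norm (fst (snd p) - snd (snd p))))"
      by (rule continuous_on_compose2[OF continuous_on_N])
        (use K_dom in \<open>force intro!: continuous_intros\<close>)+
    have p: "continuous_on K (\<lambda>p. penalty \<epsilon> (fst (snd p)))"
      by (rule continuous_on_compose2[OF continuous_penalty[of UNIV]]) (auto intro!: continuous_intros)
    have ne: "(fst p - \<tau>) * N (norm (fst (snd p) - snd (snd p))) / M \<rho> \<noteq> 0" if "p \<in> K" for p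
      using K_dom[of "fst p" "fst (snd p)" "snd (snd p)"] N_pos[of "norm (fst (snd p) - snd (snd p))"] that M_\<rho>_pos
      by simp
    show ?thesis
      unfolding w_def \<Psi>_def case_prod_beta
      by (intro continuous_intros q1 q2 n p) (use ne M_\<rho>_pos in auto)
  qed
  have "(t, x, y) \<in> K"
    using localize[of t x y] t xy by (simp add: \<delta>_def)
  then obtain p where p: "p \<in> K" and p_max: "\<And>p'. p' \<in> K \<Longrightarrow> w p' \<le> w p"
    using continuous_attains_sup[OF K_compact _ w_cont] by blast
  obtain t1 x1 y1 where p_eq: "p = (t1, x1, y1)" by (cases p) auto
  have t1: "\<tau> < t1" "t1 \<le> 1" "x1 \<noteq> y1"
    using K_dom[of t1 x1 y1] p p_eq by auto
  have w1: "\<delta> \<le> w (t1, x1, y1)"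
    using p_max[OF \<open>(t, x, y) \<in> K\<close>] by (simp add: \<delta>_def p_eq)
  have global_max: "w (s, x', y') \<le> w (t1, x1, y1)" if "\<tau> < s" "s \<le> 1" "x' \<noteq> y'" for s x' y'
    using localize[OF that] p_max w1 p_eq by fastforce
  define r where "r = norm (x1 - y1)"
  define T where "T = t1 - \<tau>"
  have far: "M \<rho> < T * N r" and r: "0 < r" "r < \<rho>"
    using localize[OF t1 w1] t1 by (auto simp: T_def r_def)
  have T: "0 < T" "T \<le> 1" using t1 \<tau> by (auto simp: T_def)
  have Nr: "0 < N r" by (rule N_pos[OF r(1)])
  have N_M: "N r = M r" using r by (simp add: N_eq)
  define H where "H = T * N r / M \<rho>"
  have H1: "1 < H" using far M_\<rho>_pos by (simp add: H_def)
  define \<Phi> where "\<Phi> = 2 * B * H powr (- b)"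
  have "H powr (- b) \<le> H powr 0" using H1 b by (intro powr_mono) auto
  then have "H powr (- b) \<le> 1" using H1 by simp
  then have \<Psi>1: "2 * B * \<Psi> t1 r = \<Phi>"
    unfolding \<Psi>_def \<Phi>_def T_def[symmetric] H_def[symmetric] by simp
  have \<Phi>0: "0 < \<Phi>" using B H1 by (simp add: \<Phi>_def)
  have w1_eq: "w (t1, x1, y1) = q t1 x1 - q t1 y1 - \<Phi> - 3 * B * penalty \<epsilon> x1"
    using \<Psi>1 by (simp add: w_def r_def)
  have spatial: "q t1 x' - q t1 y' - \<Phi> * (N (norm (x1 - y1)) / N (norm (x' - y'))) powr b - 3 * B * penalty \<epsilon> x'
      \<le> q t1 x1 - q t1 y1 - \<Phi> - 3 * B * penalty \<epsilon> x1" if "x' \<noteq> y'" for x' y'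
  proof -
    define s where "s = norm (x' - y')"
    have Ns: "0 < N s" using that by (intro N_pos) (simp add: s_def)
    have "T * N s / M \<rho> = H * (N s / N r)" using Nr by (simp add: H_def)
    then have "(T * N s / M \<rho>) powr (- b) = (H * (N s / N r)) powr (- b)"
      by (simp only:)
    also have "\<dots> = H powr (- b) * (N s / N r) powr (- b)"
      by (rule powr_mult)
    also have "(N s / N r) powr (- b) = (N r / N s) powr b"
      using Ns Nr by (simp add: powr_minus powr_divide)
    finally have "\<Psi> t1 s \<le> H powr (- b) * (N r / N s) powr b"
      by (simp add: \<Psi>_def T_def)
    then have "2 * B * \<Psi> t1 s \<le> \<Phi> * (N r / N s) powr b"
      using mult_left_mono[of "\<Psi> t1 s" "H powr (- b) * (N r / N s) powr b" "2 * B"] B(1)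
      by (simp add: \<Phi>_def mult.assoc)
    then show ?thesis
      using global_max[OF t1(1,2) that] unfolding w1_eq by (simp add: w_def s_def r_def)
  qed
  have t1_pos: "0 < t1" using t1 \<tau> by simp
  have eqn: "integrable lebesgue (\<lambda>z. (q t1 x - q t1 (x + z)) * k x z t1) \<and>
        (\<exists>q' g. ((\<lambda>s. q s x) has_real_derivative q') (at t1) \<and>
                gderiv (q t1) x g \<and> q' + v t1 x \<bullet> g + nonlocal_op k q t1 x = 0)" for x
    using sol t1_pos unfolding bounded_solution_def by blast
  obtain qx gx where X: "((\<lambda>s. q s x1) has_real_derivative qx) (at t1)" "gderiv (q t1) x1 gx"
      "qx + v t1 x1 \<bullet> gx + nonlocal_op k q t1 x1 = 0"
    using eqn[of x1] by blast
  obtain qy gy where Y: "((\<lambda>s. q s y1) has_real_derivative qy) (at t1)" "gderiv (q t1) y1 gy"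
      "qy + v t1 y1 \<bullet> gy + nonlocal_op k q t1 y1 = 0"
    using eqn[of y1] by blast
  define err where "err = 3 * B * (3 * \<epsilon> * C1 + C * (\<integral>z. min 1 (\<epsilon> * norm z) \<partial>\<nu>))"
  have "\<Phi> \<le> q t1 x1 - q t1 y1"
  proof -
    have "0 \<le> 3 * B * penalty \<epsilon> x1" using B penalty_nonneg[of \<epsilon> x1] \<epsilon> by simp
    then show ?thesis using w1 \<delta> unfolding w1_eq by linarith
  qed
  then have upper: "qx - qy \<le> M r * \<Phi> * (34 * \<sigma> * C * b + C2 * b - gain C) + err"
    unfolding r_def err_def
    using inequality_at_spatial_max[OF A1 A6 C t1_pos t1(3) _ _ X(2,3) _ Y(2,3) b _ _ _ \<epsilon> spatial]
      r eqn \<Phi>0 B(1) by (simp add: r_def)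
  have lower: "0 \<le> qx - qy + b * \<Phi> / T"
  proof (rule ccontr)
    assume neg: "\<not> 0 \<le> qx - qy + b * \<Phi> / T"
    \<comment> \<open>Dropping the minimum with \<open>1\<close> raises the barrier, with equality at \<open>t1\<close>, so \<open>t1\<close> still beats earlier times.\<close>
    define f where "f s = q s x1 - q s y1 - 2 * B * ((s - \<tau>) * (N r / M \<rho>)) powr (- b)" for s
    have c: "0 < N r / M \<rho>" using Nr M_\<rho>_pos by simp
    have TH: "(t1 - \<tau>) * (N r / M \<rho>) = H" by (simp add: T_def H_def)
    have "((\<lambda>s. ((s - \<tau>) * (N r / M \<rho>)) powr (- b)) has_real_derivative
        (- b) * H powr (- b - 1) * (N r / M \<rho>)) (at t1)"
    proof -
      have "((\<lambda>s. (s - \<tau>) * (N r / M \<rho>)) has_real_derivative N r / M \<rho>) (at t1)"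
        using M_\<rho>_pos by (auto intro!: derivative_eq_intros)
      from DERIV_fun_powr[OF this, of "- b"] show ?thesis
        unfolding TH using H1 by (simp add: mult_ac)
    qed
    then have "(f has_real_derivative qx - qy - 2 * B * ((- b) * H powr (- b - 1) * (N r / M \<rho>))) (at t1)"
      unfolding f_def[abs_def] by (intro DERIV_diff X Y DERIV_cmult)
    moreover have "(- b) * H powr (- b - 1) * (N r / M \<rho>) = (- b) * (H powr (- b) / T)"
    proof -
      have "H powr (- b - 1) = H powr (- b) / H"
        using H1 powr_diff[of H "- b" 1] by simp
      moreover have "N r / M \<rho> = H / T" using T by (simp add: H_def)
      ultimately show ?thesis using H1 by simp
    qed
    ultimately have "(f has_real_derivative qx - qy - 2 * B * ((- b) * (H powr (- b) / T))) (at t1)"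
      by (simp only:)
    then have "(f has_real_derivative qx - qy + b * \<Phi> / T) (at t1)"
      by (simp add: \<Phi>_def mult_ac)
    then obtain d where d: "0 < d" "\<And>h. 0 < h \<Longrightarrow> h < d \<Longrightarrow> f t1 < f (t1 - h)"
      using DERIV_neg_dec_left[of f "qx - qy + b * \<Phi> / T" t1] neg by auto
    define h where "h = min (d / 2) (T / 2)"
    have h: "0 < h" "h < d" "h < T" using d T by (auto simp: h_def)
    define s where "s = t1 - h"
    have s: "\<tau> < s" "s \<le> 1" using h t1 by (auto simp: s_def T_def)
    have "2 * B * \<Psi> s r \<le> 2 * B * ((s - \<tau>) * (N r / M \<rho>)) powr (- b)"
      using B(1) by (intro mult_left_mono) (auto simp: \<Psi>_def)
    then have "f s \<le> q s x1 - q s y1 - 2 * B * \<Psi> s r"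
      by (simp add: f_def)
    also have "\<dots> \<le> q t1 x1 - q t1 y1 - \<Phi>"
      using global_max[OF s t1(3)] unfolding w1_eq by (simp add: w_def r_def)
    also have "\<dots> = f t1"
      unfolding f_def TH \<Phi>_def by simp
    finally show False using d(2)[OF h(1,2)] by (simp add: s_def)
  qed
  have MP: "2 * B * M \<rho> \<le> M r * \<Phi>"
  proof -
    define h where "h = M r / M \<rho>"
    have Hh: "H \<le> h" using T Nr M_\<rho>_pos by (simp add: H_def h_def N_M divide_right_mono)
    then have h1: "1 \<le> h" using H1 by simp
    have "h * h powr (- 1) \<le> h * h powr (- b)"
      using h1 b by (intro mult_left_mono powr_mono) auto
    also have "\<dots> \<le> h * H powr (- b)"
      using h1 H1 b Hh by (intro mult_left_mono powr_mono2') auto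
    finally have "1 \<le> h * H powr (- b)" using h1 by (simp add: powr_minus)
    then have "2 * B * M \<rho> * 1 \<le> 2 * B * M \<rho> * (h * H powr (- b))"
      using B(1) M_\<rho>_pos by (intro mult_left_mono) auto
    also have "\<dots> = M r * \<Phi>" using M_\<rho>_pos by (simp add: h_def \<Phi>_def)
    finally show ?thesis by simp
  qed
  have "b * \<Phi> / T \<le> M r * \<Phi> * (b / M \<rho>)"
  proof -
    have "1 / T \<le> M r / M \<rho>" using far T M_\<rho>_pos by (simp add: N_M field_simps)
    then have "b * \<Phi> * (1 / T) \<le> b * \<Phi> * (M r / M \<rho>)"
      using b \<Phi>0 by (intro mult_left_mono) auto
    then show ?thesis by (simp add: mult_ac)
  qed
  with upper lower have "0 \<le> M r * \<Phi> * (34 * \<sigma> * C * b + C2 * b - gain C) + M r * \<Phi> * (b / M \<rho>) + err"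
    by linarith
  also have "\<dots> = M r * \<Phi> * (34 * \<sigma> * C * b + C2 * b + b / M \<rho> - gain C) + err"
    by (simp add: algebra_simps)
  also have "\<dots> \<le> M r * \<Phi> * (- (gain C / 2)) + err"
  proof (intro add_right_mono mult_left_mono)
    show "34 * \<sigma> * C * b + C2 * b + b / M \<rho> - gain C \<le> - (gain C / 2)"
      using small_b by linarith
  qed (use Nr N_M \<Phi>0 in auto)
  also have "\<dots> < 0"
  proof -
    have "0 < gain C" using C \<sigma>_pos by (simp add: gain_def)
    then have "gain C / 2 * (2 * B * M \<rho>) \<le> gain C / 2 * (M r * \<Phi>)"
      using MP by (intro mult_left_mono) auto
    moreover have "err < gain C / 2 * (2 * B * M \<rho>)"
      using small_\<epsilon> by (simp only: err_def)
    moreover have "M r * \<Phi> * (- (gain C / 2)) = - (gain C / 2 * (M r * \<Phi>))"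
      by simp
    ultimately show ?thesis by linarith
  qed
  finally show False by simp
qed

text \<open>
  First \<open>\<epsilon>\<close> and then \<open>\<tau>\<close> tend to \<open>0\<close>.
\<close>

lemma modulus_of_continuity:
  fixes k :: "'a \<Rightarrow> 'a \<Rightarrow> real \<Rightarrow> real" and v :: "real \<Rightarrow> 'a \<Rightarrow> 'a" and q :: "real \<Rightarrow> 'a \<Rightarrow> real"
  assumes A1: "assm_A1 C \<eta> k" and A6: "assm_A6 C1 C2 \<eta> v" and C: "0 < C" "0 < C1" "0 < C2"
    and sol: "bounded_solution k v q"
    and B: "0 < B" "\<And>t x. 0 \<le> t \<Longrightarrow> t \<le> 1 \<Longrightarrow> \<bar>q t x\<bar> \<le> B"
    and b: "0 \<le> b" "b \<le> 1 / 2"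
    and small_b: "34 * \<sigma> * C * b + C2 * b + b / M \<rho> \<le> gain C / 2"
    and t: "0 < t" "t \<le> 1" and xy: "x \<noteq> y"
  shows "q t x - q t y \<le> 2 * B * (t * N (norm (x - y)) / M \<rho>) powr (- b)"
proof -
  define \<epsilon> where "\<epsilon> n = 1 / real (Suc n)" for n
  have \<epsilon>_pos: "0 < \<epsilon> n" for n by (simp add: \<epsilon>_def)
  have \<epsilon>_lim: "\<epsilon> \<longlonglongrightarrow> 0"
    unfolding \<epsilon>_def using LIMSEQ_inverse_real_of_nat by (simp add: inverse_eq_divide)
  have gain_pos: "0 < gain C" using C \<sigma>_pos by (simp add: gain_def)
  have "(\<lambda>n. 3 * B * (3 * \<epsilon> n * C1 + C * (\<integral>z. min 1 (\<epsilon> n * norm z) \<partial>\<nu>))) \<longlonglongrightarrow> 3 * B * (3 * 0 * C1 + C * 0)"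
    unfolding \<epsilon>_def
    by (intro tendsto_intros penalty_cost_tendsto_0 \<epsilon>_lim[unfolded \<epsilon>_def])
  moreover have "3 * B * (3 * 0 * C1 + C * 0) < gain C / 2 * (2 * B * M \<rho>)"
    using gain_pos B M_\<rho>_pos by simp
  ultimately have small: "\<forall>\<^sub>F n in sequentially.
      3 * B * (3 * \<epsilon> n * C1 + C * (\<integral>z. min 1 (\<epsilon> n * norm z) \<partial>\<nu>)) < gain C / 2 * (2 * B * M \<rho>)"
    by (rule order_tendstoD(2))
  have delayed: "q t x - q t y \<le> 2 * B * ((t - \<tau>) * N (norm (x - y)) / M \<rho>) powr (- b)"
    if \<tau>: "0 < \<tau>" "\<tau> < t" for \<tau>
  proof -
    define \<Theta> where "\<Theta> = 2 * B * min 1 (((t - \<tau>) * N (norm (x - y)) / M \<rho>) powr (- b))"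
    have "(\<lambda>n. \<Theta> + 3 * B * penalty (\<epsilon> n) x) \<longlonglongrightarrow> \<Theta> + 3 * B * 0"
      by (intro tendsto_intros penalty_tendsto_0 \<epsilon>_lim)
    moreover have "\<forall>\<^sub>F n in sequentially. q t x - q t y \<le> \<Theta> + 3 * B * penalty (\<epsilon> n) x"
      using small
    proof eventually_elim
      case (elim n)
      show ?case
        unfolding \<Theta>_def
        by (rule penalized_comparison[OF A1 A6 C sol B b small_b \<epsilon>_pos elim \<tau> t(2) xy])
    qed
    ultimately have "q t x - q t y \<le> \<Theta> + 3 * B * 0"
      by (intro tendsto_lowerbound[where F = sequentially]) auto
    also have "\<dots> \<le> 2 * B * ((t - \<tau>) * N (norm (x - y)) / M \<rho>) powr (- b)"
      using B(1) by (simp add: \<Theta>_def)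
    finally show ?thesis .
  qed
  have pos: "0 < t * N (norm (x - y)) / M \<rho>"
    using t xy N_pos[of "norm (x - y)"] M_\<rho>_pos by simp
  have "((\<lambda>\<tau>. 2 * B * ((t - \<tau>) * N (norm (x - y)) / M \<rho>) powr (- b)) \<longlongrightarrow>
      2 * B * ((t - 0) * N (norm (x - y)) / M \<rho>) powr (- b)) (at_right 0)"
    by (intro tendsto_intros) (use pos M_\<rho>_pos in auto)
  moreover have "\<forall>\<^sub>F \<tau> in at_right 0. q t x - q t y \<le> 2 * B * ((t - \<tau>) * N (norm (x - y)) / M \<rho>) powr (- b)"
    using delayed t by (auto simp: eventually_at_right intro!: exI[of _ t])
  ultimately have "q t x - q t y \<le> 2 * B * ((t - 0) * N (norm (x - y)) / M \<rho>) powr (- b)"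
    by (rule tendsto_lowerbound) simp
  then show ?thesis by simp
qed

end

section \<open>From the scaling assumptions to the estimate\<close>

text \<open>
  Multiplying the monotone function \<open>r powr \<gamma> * M r\<close> by \<open>r powr (1 / 2 - \<gamma>)\<close> replaces \<open>\<gamma>\<close> by \<open>1 / 2\<close>.
  For \<open>doubling\<close>, the monotonicity of \<open>r ^ d * \<eta> r / M r\<close> is combined with \<open>M s \<le> 2 * M s'\<close>.
  Since \<open>M\<close> blows up at \<open>0\<close>, both \<open>R\<close> and then \<open>\<rho>\<close> can be chosen.
\<close>

lemma ex_critical_profile:
  fixes \<eta> :: "real \<Rightarrow> real"
  assumes nonneg: "\<And>r. r > 0 \<Longrightarrow> \<eta> r \<ge> 0"
    and A3: "assm_A3 DIM('a::euclidean_space) \<eta>"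
    and A4: "assm_A4 DIM('a) \<eta>"
    and A5: "assm_A5 DIM('a) \<eta>"
  obtains R \<rho> where "critical_profile \<eta> (M_eta DIM('a) \<eta>) (sphere_area TYPE('a))
    (\<lambda>z::'a. if z = 0 then 0 else \<eta> (norm z)) R \<rho>"
proof -
  interpret radial_profile \<eta> "M_eta DIM('a) \<eta>" "sphere_area TYPE('a)"
    "\<lambda>z::'a. if z = 0 then 0 else \<eta> (norm z)"
    using nonneg A3 by unfold_locales (auto simp: assm_A3_def)
  let ?M = "M_eta DIM('a) \<eta>"
  have large: "\<exists>e>0. \<forall>r. 0 < r \<and> r < e \<longrightarrow> c < ?M r" for c
  proof -
    have "\<forall>\<^sub>F r in at_right 0. c < ?M r"
      using A3 by (simp add: assm_A3_def filterlim_at_top_dense)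
    then show ?thesis unfolding eventually_at_right_field by auto
  qed
  obtain r4 where r4: "0 < r4" "mono_on {0<..r4} (\<lambda>r. r ^ DIM('a) * \<eta> r / ?M r)"
    using A4 by (auto simp: assm_A4_def)
  obtain \<gamma> r5 where \<gamma>: "0 < \<gamma>" "\<gamma> \<le> 1 / 2" and r5: "0 < r5" "mono_on {0<..r5} (\<lambda>r. r powr \<gamma> * ?M r)"
    using A5 by (auto simp: assm_A5_def)
  obtain e where e: "0 < e" "\<And>r. 0 < r \<Longrightarrow> r < e \<Longrightarrow> 0 < ?M r"
    using large[of 0] by auto
  define R where "R = Min {1, r4, r5, e / 2}"
  have R: "0 < R" "R \<le> 1" "R \<le> r4" "R \<le> r5" "R < e"
    using r4(1) r5(1) e(1) by (auto simp: R_def min_less_iff_disj)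
  obtain e' where e': "0 < e'" "\<And>r. 0 < r \<Longrightarrow> r < e' \<Longrightarrow> 2 * ?M (R / 2) < ?M r"
    using large[of "2 * ?M (R / 2)"] by auto
  define \<rho> where "\<rho> = min (R / 2) (e' / 2)"
  have \<rho>: "0 < \<rho>" "2 * \<rho> \<le> R" "\<rho> < e'" "\<rho> < e"
    using R e' e(1) by (auto simp: \<rho>_def min_def)
  have sqrt_growth: "sqrt r * ?M r \<le> sqrt s * ?M s" if "0 < r" "r \<le> s" "s \<le> R" for r s
  proof -
    have split: "sqrt p = p powr (1 / 2 - \<gamma>) * p powr \<gamma>" if "0 < p" for p :: real
      using that by (simp add: powr_half_sqrt[symmetric] powr_add[symmetric])
    have m1: "r powr \<gamma> * ?M r \<le> s powr \<gamma> * ?M s"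
      using that R by (intro mono_onD[OF r5(2)]) auto
    have m2: "r powr (1 / 2 - \<gamma>) \<le> s powr (1 / 2 - \<gamma>)"
      using that \<gamma> by (intro powr_mono2) auto
    have "r powr (1 / 2 - \<gamma>) * (r powr \<gamma> * ?M r) \<le> s powr (1 / 2 - \<gamma>) * (s powr \<gamma> * ?M s)"
      by (rule mult_mono[OF m2 m1]) (use that M_nonneg[of r] in auto)
    then show ?thesis using that split[of r] split[of s] by (simp add: mult.assoc)
  qed
  have doubling: "\<eta> s \<le> 2 ^ (DIM('a) + 1) * \<eta> s'" if s: "0 < s" "s \<le> s'" "s' \<le> 2 * s" "s' \<le> R" for s s'
  proof -
    have Ms: "0 < ?M s" "0 < ?M s'" using e(2) s R by auto
    have "sqrt s * ?M s \<le> sqrt (2\<^sup>2 * s) * ?M s'"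
    proof -
      have "sqrt s * ?M s \<le> sqrt s' * ?M s'" by (rule sqrt_growth) (use s in auto)
      also have "\<dots> \<le> sqrt (2\<^sup>2 * s) * ?M s'"
        using s Ms by (intro mult_right_mono real_sqrt_le_mono) auto
      finally show ?thesis .
    qed
    then have M2: "?M s \<le> 2 * ?M s'" using s by (simp add: real_sqrt_mult)
    have "s ^ DIM('a) * \<eta> s / ?M s \<le> s' ^ DIM('a) * \<eta> s' / ?M s'"
      using s R by (intro mono_onD[OF r4(2)]) auto
    also have "\<dots> \<le> (2 * s) ^ DIM('a) * \<eta> s' / ?M s'"
      using s Ms nonneg[of s'] by (intro divide_right_mono mult_right_mono power_mono) auto
    finally have "s ^ DIM('a) * \<eta> s \<le> (2 * s) ^ DIM('a) * \<eta> s' / ?M s' * ?M s"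
      using Ms by (simp add: pos_divide_le_eq)
    also have "\<dots> \<le> (2 * s) ^ DIM('a) * \<eta> s' / ?M s' * (2 * ?M s')"
      using M2 s Ms nonneg[of s'] by (intro mult_left_mono) auto
    also have "\<dots> = s ^ DIM('a) * (2 ^ (DIM('a) + 1) * \<eta> s')"
      using Ms by (simp add: power_mult_distrib)
    finally show ?thesis using s by simp
  qed
  show ?thesis
  proof (rule that, unfold_locales)
    show "R \<le> 1" "0 < \<rho>" "2 * \<rho> \<le> R" by fact+
    show "2 * ?M (R / 2) \<le> ?M \<rho>" using e'(2)[of \<rho>] \<rho> by simp
    show "0 < ?M \<rho>" using e(2) \<rho> by simp
  qed (fact sqrt_growth doubling)+
qed

theorem proposition3p1:
  fixes \<eta> :: "real \<Rightarrow> real" and C C1 C2 :: real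
  assumes "\<And>r. r > 0 \<Longrightarrow> \<eta> r \<ge> 0"
    and "C > 0" and "C1 > 0" and "C2 > 0"
    and "assm_A2 DIM('a::euclidean_space) \<eta>"
    and "assm_A3 DIM('a) \<eta>"
    and "assm_A4 DIM('a) \<eta>"
    and "assm_A5 DIM('a) \<eta>"
  shows "\<exists>\<beta> r0 c' K. 0 < \<beta> \<and> \<beta> < 1 \<and> 0 < r0 \<and> 0 < c' \<and> 0 < K \<and>
    (\<forall>(k :: 'a \<Rightarrow> 'a \<Rightarrow> real \<Rightarrow> real) (v :: real \<Rightarrow> 'a \<Rightarrow> 'a) (q :: real \<Rightarrow> 'a \<Rightarrow> real).
       assm_A1 C \<eta> k \<and> assm_A6 C1 C2 \<eta> v \<and> bounded_solution k v q \<longrightarrow>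
       (\<forall>t x y. 0 < t \<and> t \<le> 1 \<and> x \<noteq> y \<and> norm (x - y) \<le> r0 \<and>
            M_eta DIM('a) \<eta> (norm (x - y)) \<ge> c' / t \<longrightarrow>
          \<bar>q t x - q t y\<bar> \<le>
            K * t powr (- \<beta>) * M_eta DIM('a) \<eta> (norm (x - y)) powr (- \<beta>) *
            (SUP (s, z)\<in>{0..1} \<times> UNIV. \<bar>q s z\<bar>)))"
proof -
  obtain R \<rho> where "critical_profile \<eta> (M_eta DIM('a) \<eta>) (sphere_area TYPE('a))
    (\<lambda>z::'a. if z = 0 then 0 else \<eta> (norm z)) R \<rho>"
    using ex_critical_profile assms by metis
  then interpret critical_profile \<eta> "M_eta DIM('a) \<eta>" "sphere_area TYPE('a)"
    "\<lambda>z::'a. if z = 0 then 0 else \<eta> (norm z)" R \<rho> .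
  let ?M = "M_eta DIM('a) \<eta>" and ?\<sigma> = "sphere_area TYPE('a)"
  define L where "L = 34 * ?\<sigma> * C + C2 + 1 / ?M \<rho>"
  have L: "0 < L" using assms \<sigma>_pos M_\<rho>_pos by (simp add: L_def add_pos_pos)
  have gain_pos: "0 < gain C" using assms \<sigma>_pos by (simp add: gain_def)
  define b where "b = min (1 / 2) (gain C / 2 / L)"
  have b: "0 < b" "b \<le> 1 / 2" using L gain_pos by (auto simp: b_def)
  have "34 * ?\<sigma> * C * b + C2 * b + b / ?M \<rho> = b * L"
    by (simp add: L_def algebra_simps)
  also have "\<dots> \<le> gain C / 2 / L * L"
    using L by (intro mult_right_mono) (auto simp: b_def)
  also have "\<dots> = gain C / 2" using L by simp
  finally have small_b: "34 * ?\<sigma> * C * b + C2 * b + b / ?M \<rho> \<le> gain C / 2" .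
  show ?thesis
  proof (rule exI[of _ b], rule exI[of _ \<rho>], rule exI[of _ "?M \<rho>"],
      rule exI[of _ "2 * ?M \<rho> powr b"], intro conjI allI impI)
    fix k :: "'a \<Rightarrow> 'a \<Rightarrow> real \<Rightarrow> real" and v :: "real \<Rightarrow> 'a \<Rightarrow> 'a" and q :: "real \<Rightarrow> 'a \<Rightarrow> real" and t and x y :: 'a
    assume "assm_A1 C \<eta> k \<and> assm_A6 C1 C2 \<eta> v \<and> bounded_solution k v q"
    then have A1: "assm_A1 C \<eta> k" and A6: "assm_A6 C1 C2 \<eta> v" and sol: "bounded_solution k v q" by auto
    assume *: "0 < t \<and> t \<le> 1 \<and> x \<noteq> y \<and> norm (x - y) \<le> \<rho> \<and> ?M \<rho> / t \<le> ?M (norm (x - y))"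
    define B where "B = (SUP (s, z)\<in>{0..1} \<times> (UNIV :: 'a set). \<bar>q s z\<bar>)"
    obtain B' where B': "\<And>s z. 0 \<le> s \<Longrightarrow> \<bar>q s z\<bar> \<le> B'"
      using sol by (auto simp: bounded_solution_def)
    have B: "\<bar>q s z\<bar> \<le> B" if "0 \<le> s" "s \<le> 1" for s z
    proof -
      have "bdd_above ((\<lambda>(s, z). \<bar>q s z\<bar>) ` ({0..1} \<times> (UNIV :: 'a set)))"
        using B' by (intro bdd_aboveI[of _ B']) auto
      from cSUP_upper[OF _ this, of "(s, z)"] that show ?thesis by (simp add: B_def)
    qed
    \<comment> \<open>A solution that vanishes up to time \<open>1\<close> is treated apart, because the error terms are absorbed by a multiple of \<open>B\<close>.\<close>
    have "\<bar>q t x - q t y\<bar> \<le> 2 * B * (t * ?M (norm (x - y)) / ?M \<rho>) powr (- b)"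
    proof (cases "B = 0")
      case True
      have "\<bar>q t x\<bar> \<le> B" "\<bar>q t y\<bar> \<le> B" by (intro B; use * in simp)+
      with True show ?thesis by simp
    next
      case False
      have "0 \<le> B" using B[of 0 x] by simp
      with False have Bp: "0 < B" by simp
      have "q t x - q t y \<le> 2 * B * (t * N (norm (x - y)) / ?M \<rho>) powr (- b)"
        by (rule modulus_of_continuity[OF A1 A6 assms(2-4) sol Bp B _ b(2) small_b]) (use * b in auto)
      moreover have "q t y - q t x \<le> 2 * B * (t * N (norm (y - x)) / ?M \<rho>) powr (- b)"
        by (rule modulus_of_continuity[OF A1 A6 assms(2-4) sol Bp B _ b(2) small_b]) (use * b in auto)
      ultimately show ?thesis
        using * by (simp add: N_eq norm_minus_commute abs_le_iff)
    qed
    also have "(t * ?M (norm (x - y)) / ?M \<rho>) powr (- b) =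
        ?M \<rho> powr b * t powr (- b) * ?M (norm (x - y)) powr (- b)"
      using * M_nonneg[of "norm (x - y)"] M_\<rho>_pos
      by (simp add: powr_mult powr_divide powr_minus field_simps)
    finally show "\<bar>q t x - q t y\<bar> \<le> 2 * ?M \<rho> powr b * t powr (- b) * ?M (norm (x - y)) powr (- b) *
      (SUP (s, z)\<in>{0..1} \<times> UNIV. \<bar>q s z\<bar>)"
      by (simp add: B_def mult_ac)
  qed (use b \<rho>_pos M_\<rho>_pos in auto)
qed

end
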